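(* Let $P$ be a standard RAP with parameters $k,m,n$ and zero set $Z$, and let $r$ be a row of the matrix containing no position of $Z$. Then the probability that the optimal $k$-assignment contains a position in row $r$ equals \[ \frac1m\sum_{i}\frac{\overline{d_{i,0}}(P)}{\binom{m-1}{i}}, \] where $\overline{d_{i,0}}(P)$ is the number of partial $(k-1)$-covers of $Z$ consisting of exactly $i$ rows and no columns and not containing row $r$, and the sum is over integers $0\le i\le k-1$.
   Context: Let $k,m,n$ be positive integers with $\min(m,n)\ge k$. A $k$-assignment in an $m\times n$ matrix is a set of $k$ positions, no two in the same row or column; its cost is the sum of the entries there. A standard RAP is given by $k,m,n$ and a set $Z$ of positions: entries at positions of $Z$ are $0$ and all other entries are independent exponential random variables with intensity $1$. With probability $1$ a nonzero entry lies either in every optimal (minimal cost) $k$-assignment or in none, so the event that "the optimal $k$-assignment" uses a given zero-free row is well defined almost surely. A set $\lambda$ of rows and columns covers $Z$ if each position of $Z$ lies in a row or column of $\lambda$; a cover with $s$ rows and columns in total is an $s$-cover; a partial $(k-1)$-cover is a subset of some $(k-1)$-cover of $Z$. *)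

theory Defs
  imports "HOL-Probability.Probability"
begin

text \<open>
  Rows of an \<open>m \<times> n\<close> matrix are indexed by \<open>{..<m}\<close>, columns by \<open>{..<n}\<close>.
\<close>

definition positions :: "nat \<Rightarrow> nat \<Rightarrow> (nat \<times> nat) set" where
  "positions m n = {..<m} \<times> {..<n}"

definition k_assignment :: "nat \<Rightarrow> nat \<Rightarrow> nat \<Rightarrow> (nat \<times> nat) set \<Rightarrow> bool" where
  "k_assignment k m n A \<longleftrightarrow>
     A \<subseteq> positions m n \<and> card A = k \<and> inj_on fst A \<and> inj_on snd A"

definition cost :: "(nat \<times> nat \<Rightarrow> real) \<Rightarrow> (nat \<times> nat) set \<Rightarrow> real" where
  "cost c A = (\<Sum>p\<in>A. c p)"

definition optimal_assignment ::
  "nat \<Rightarrow> nat \<Rightarrow> nat \<Rightarrow> (nat \<times> nat \<Rightarrow> real) \<Rightarrow> (nat \<times> nat) set \<Rightarrow> bool" where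
  "optimal_assignment k m n c A \<longleftrightarrow>
     k_assignment k m n A \<and> (\<forall>B. k_assignment k m n B \<longrightarrow> cost c A \<le> cost c B)"

definition uses_row :: "nat \<Rightarrow> (nat \<times> nat) set \<Rightarrow> bool" where
  "uses_row r A \<longleftrightarrow> (\<exists>j. (r, j) \<in> A)"

locale standard_RAP = prob_space M for M :: "'a measure" +
  fixes k m n :: nat and Z :: "(nat \<times> nat) set" and X :: "nat \<times> nat \<Rightarrow> 'a \<Rightarrow> real"
  assumes k_pos: "k \<ge> 1"
    and k_le: "k \<le> min m n"
    and Z_subset: "Z \<subseteq> positions m n"
    and X_zero: "\<And>p \<omega>. p \<in> Z \<Longrightarrow> \<omega> \<in> space M \<Longrightarrow> X p \<omega> = 0"
    and X_exponential:
      "\<And>p. p \<in> positions m n - Z \<Longrightarrow> distributed M lborel (X p) (exponential_density 1)"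
    and X_indep: "indep_vars (\<lambda>_. borel) X (positions m n - Z)"

text \<open>
  A set of rows and columns is a set of type \<open>(nat + nat) set\<close>:
  \<open>Inl i\<close> is row \<open>i\<close> and \<open>Inr j\<close> is column \<open>j\<close>.
\<close>

definition covers :: "(nat + nat) set \<Rightarrow> (nat \<times> nat) set \<Rightarrow> bool" where
  "covers L Z \<longleftrightarrow> (\<forall>(i, j)\<in>Z. Inl i \<in> L \<or> Inr j \<in> L)"

definition s_cover :: "nat \<Rightarrow> nat \<Rightarrow> nat \<Rightarrow> (nat \<times> nat) set \<Rightarrow> (nat + nat) set \<Rightarrow> bool" where
  "s_cover s m n Z L \<longleftrightarrow> L \<subseteq> {..<m} <+> {..<n} \<and> covers L Z \<and> card L = s"

definition partial_s_cover ::
  "nat \<Rightarrow> nat \<Rightarrow> nat \<Rightarrow> (nat \<times> nat) set \<Rightarrow> (nat + nat) set \<Rightarrow> bool" where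
  "partial_s_cover s m n Z L \<longleftrightarrow> (\<exists>L'. s_cover s m n Z L' \<and> L \<subseteq> L')"

text \<open>
  The number of partial \<open>(k - 1)\<close>-covers consisting of exactly \<open>i\<close> rows,
  none of them \<open>r\<close>, and no columns.
\<close>

definition d_bar_row ::
  "nat \<Rightarrow> nat \<Rightarrow> nat \<Rightarrow> (nat \<times> nat) set \<Rightarrow> nat \<Rightarrow> nat \<Rightarrow> nat" where
  "d_bar_row k m n Z r i =
     card {L. partial_s_cover (k - 1) m n Z L \<and>
              card {a. Inl a \<in> L} = i \<and> {b. Inr b \<in> L} = {} \<and> Inl r \<notin> L}"

end

theory Submission imports Defs begin

text \<open>
  For a set \<open>E\<close> of rows let \<open>F\<close> be the set of columns with a zero outside \<open>E\<close>. Call \<open>E\<close> a flat of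
  rank \<open>j = |E| + |F|\<close> if zeros outside \<open>E\<close> match all of \<open>F\<close>, even when one more row is forbidden.
  Almost surely the rows used by every optimal \<open>j\<close>-assignment form a flat \<open>E\<^sub>j\<close>, and \<open>E\<^sub>j = E\<close> holds
  iff the optimal \<open>|E|\<close>-assignment in the columns outside \<open>F\<close> uses exactly the rows \<open>E\<close>: any
  \<open>j\<close>-assignment has at least \<open>|E|\<close> entries in these columns, and \<open>F\<close> can be filled up with zeros.
  In these columns all rows outside \<open>E\<close> are independent and identically distributed, so the row
  \<open>a\<close> which the optimal \<open>(|E| + 1)\<close>-assignment adds to \<open>E\<close> is uniformly distributed outside \<open>E\<close>,
  and \<open>E\<close> at rank \<open>j + 1\<close> is the smallest flat containing \<open>E \<union> {a}\<close>.

  Hence the flats evolve as the closures of the initial segments of a uniformly random ordering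
  of all rows, and \<open>r\<close> is used iff the rows preceding \<open>r\<close> extend to a \<open>(k - 1)\<close>-cover. A set of
  \<open>i\<close> rows is the set of predecessors of \<open>r\<close> with probability \<open>1 / (m * ((m - 1) choose i))\<close>.
\<close>

section \<open>Matchings\<close>

definition matching :: "('a \<times> 'b) set \<Rightarrow> bool" where
  "matching A \<longleftrightarrow> finite A \<and> inj_on fst A \<and> inj_on snd A"

lemma matching_subset: "matching A \<Longrightarrow> B \<subseteq> A \<Longrightarrow> matching B"
  unfolding matching_def by (meson finite_subset inj_on_subset)

lemma matching_insert:
  "matching A \<Longrightarrow> a \<notin> fst ` A \<Longrightarrow> b \<notin> snd ` A \<Longrightarrow> matching (insert (a, b) A)"
  unfolding matching_def by (auto simp: inj_on_insert)

lemma matching_Un: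
  assumes "matching A" "matching B" "fst ` A \<inter> fst ` B = {}" "snd ` A \<inter> snd ` B = {}"
  shows "matching (A \<union> B)"
  using assms unfolding matching_def by (auto simp: inj_on_Un)

lemma matching_card_fst: "matching A \<Longrightarrow> card (fst ` A) = card A"
  unfolding matching_def by (simp add: card_image)

lemma matching_card_snd: "matching A \<Longrightarrow> card (snd ` A) = card A"
  unfolding matching_def by (simp add: card_image)

lemma matching_fstD: "matching A \<Longrightarrow> (a, b) \<in> A \<Longrightarrow> (a, b') \<in> A \<Longrightarrow> b = b'"
  unfolding matching_def by (metis fst_conv inj_onD prod.inject)

lemma matching_sndD: "matching A \<Longrightarrow> (a, b) \<in> A \<Longrightarrow> (a', b) \<in> A \<Longrightarrow> a = a'"
  unfolding matching_def by (metis snd_conv inj_onD prod.inject)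

text \<open>
  If no edge of \<open>N\<close> extends \<open>M\<close> directly, a row of \<open>N\<close> outside \<open>M\<close> shares its column with an
  edge of \<open>M\<close>; deleting this column from both matchings reduces the size.
\<close>
lemma matching_augment:
  assumes "matching M" "matching N" "card N = Suc (card M)"
  shows "\<exists>M' N'. matching M' \<and> matching N' \<and> M' \<union> N' = M \<union> N \<and> M' \<inter> N' = M \<inter> N
           \<and> card M' = Suc (card M) \<and> fst ` M \<subseteq> fst ` M'"
  using assms
proof (induction "card M" arbitrary: M N rule: less_induct)
  case less
  note M = less.prems(1) and N = less.prems(2)
  have fin: "finite M" "finite N" using M N unfolding matching_def by auto
  have "card (fst ` M) < card (fst ` N)"
    using less.prems by (simp add: matching_card_fst)
  then obtain i where i: "i \<in> fst ` N" "i \<notin> fst ` M"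
    by (meson fin card_mono finite_imageI not_less subsetI)
  then obtain c where ic: "(i, c) \<in> N" by auto
  have icM: "(i, c) \<notin> M" using i(2) by force
  show ?case
  proof (cases "c \<in> snd ` M")
    case False
    have "matching (insert (i, c) M)" using M i(2) False by (rule matching_insert)
    moreover have "matching (N - {(i, c)})" using N by (rule matching_subset) auto
    moreover have "insert (i, c) M \<union> (N - {(i, c)}) = M \<union> N" using ic by auto
    moreover have "insert (i, c) M \<inter> (N - {(i, c)}) = M \<inter> N" using icM by auto
    moreover have "card (insert (i, c) M) = Suc (card M)" using icM fin by simp
    ultimately show ?thesis by blast
  next
    case True
    then obtain x where xc: "(x, c) \<in> M" by auto
    define M2 where "M2 = M - {(x, c)}"
    define N2 where "N2 = N - {(i, c)}"
    have xi: "x \<noteq> i" using xc icM by auto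
    have m2: "matching M2" "matching N2"
      using M N unfolding M2_def N2_def by (auto intro: matching_subset)
    have cM: "card M = Suc (card M2)" unfolding M2_def using fin xc
      by (metis card_Suc_Diff1)
    have cN: "card N = Suc (card N2)" unfolding N2_def using fin ic
      by (metis card_Suc_Diff1)
    obtain M' N' where IH: "matching M'" "matching N'" "M' \<union> N' = M2 \<union> N2"
        "M' \<inter> N' = M2 \<inter> N2" "card M' = Suc (card M2)" "fst ` M2 \<subseteq> fst ` M'"
      using less.hyps[of M2 N2] m2 cM cN less.prems(3) by auto
    have c2: "c \<notin> snd ` M2" "c \<notin> snd ` N2"
      unfolding M2_def N2_def using matching_sndD[OF M _ xc] matching_sndD[OF N _ ic] by auto
    have sub: "M' \<subseteq> M2 \<union> N2" "N' \<subseteq> M2 \<union> N2" using IH(3) by auto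
    have c': "c \<notin> snd ` M'" "c \<notin> snd ` N'" using c2 sub by auto
    have i2: "i \<notin> fst ` M2" "i \<notin> fst ` N2"
      unfolding M2_def N2_def using i(2) matching_fstD[OF N _ ic] by auto
    have i': "i \<notin> fst ` M'" "i \<notin> fst ` N'" using i2 sub by auto
    have x2: "x \<notin> fst ` M2" unfolding M2_def using matching_fstD[OF M _ xc] by auto
    have fM: "fst ` M = insert x (fst ` M2)" using xc unfolding M2_def by force
    have fin': "finite M'" "finite N'" using IH unfolding matching_def by auto
    have xcN: "(x, c) \<notin> N" using matching_sndD[OF N ic] xi by auto
    have U: "insert (x, c) (insert (i, c) (M2 \<union> N2)) = M \<union> N"
      using xc ic unfolding M2_def N2_def by auto
    have I: "M2 \<inter> N2 = M \<inter> N" using xcN icM unfolding M2_def N2_def by auto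
    have nin: "(i, c) \<notin> M'" "(i, c) \<notin> N'" "(x, c) \<notin> M'" "(x, c) \<notin> N'" using c' by force+
    \<comment> \<open>The edges \<open>(i, c)\<close> and \<open>(x, c)\<close> share a column, so
      they go to different matchings. If \<open>M'\<close> already uses row \<open>x\<close>, it
      takes \<open>(i, c)\<close>. Then \<open>N'\<close> misses \<open>x\<close>, since two edges
      at \<open>x\<close> would both come from \<open>N2\<close>, coincide, and hence lie in
      \<open>M2\<close>.\<close>
    show ?thesis
    proof (cases "x \<in> fst ` M'")
      case xM: True
      have xN: "x \<notin> fst ` N'"
      proof
        assume "x \<in> fst ` N'"
        then obtain d1 d2 where d: "(x, d1) \<in> M'" "(x, d2) \<in> N'" using xM by auto
        then have "(x, d1) \<in> N2" "(x, d2) \<in> N2" using sub x2 by force+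
        then have "d1 = d2" using matching_fstD[OF m2(2)] by blast
        then have "(x, d1) \<in> M2" using d IH(4) by blast
        then show False using x2 by force
      qed
      have "matching (insert (i, c) M')" using IH(1) i'(1) c'(1) by (rule matching_insert)
      moreover have "matching (insert (x, c) N')" using IH(2) xN c'(2) by (rule matching_insert)
      moreover have "insert (i, c) M' \<union> insert (x, c) N' = M \<union> N"
        unfolding U[symmetric] IH(3)[symmetric] by auto
      moreover have "insert (i, c) M' \<inter> insert (x, c) N' = M \<inter> N"
        unfolding I[symmetric] IH(4)[symmetric] using nin xi by auto
      moreover have "card (insert (i, c) M') = Suc (card M)"
        using nin fin' IH(5) cM by simp
      moreover have "fst ` M \<subseteq> fst ` insert (i, c) M'" using fM IH(6) xM by auto
      ultimately show ?thesis by blast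
    next
      case xM: False
      have "matching (insert (x, c) M')" using IH(1) xM c'(1) by (rule matching_insert)
      moreover have "matching (insert (i, c) N')" using IH(2) i'(2) c'(2) by (rule matching_insert)
      moreover have "insert (x, c) M' \<union> insert (i, c) N' = M \<union> N"
        unfolding U[symmetric] IH(3)[symmetric] by auto
      moreover have "insert (x, c) M' \<inter> insert (i, c) N' = M \<inter> N"
        unfolding I[symmetric] IH(4)[symmetric] using nin xi by auto
      moreover have "card (insert (x, c) M') = Suc (card M)"
        using nin fin' IH(5) cM by simp
      moreover have "fst ` M \<subseteq> fst ` insert (x, c) M'" using fM IH(6) by auto
      ultimately show ?thesis by blast
    qed
  qed
qed

section \<open>Hall's theorem on systems of distinct representatives\<close>

text \<open>Halmos and Vaughan: either every nonempty proper subset has surplus, or split at a tight one.\<close>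
lemma hall:
  fixes N :: "'b \<Rightarrow> 'a set"
  assumes "finite G" "\<And>b. b \<in> G \<Longrightarrow> finite (N b)"
    and "\<And>S. S \<subseteq> G \<Longrightarrow> card S \<le> card (\<Union>(N ` S))"
  shows "\<exists>f. inj_on f G \<and> (\<forall>b\<in>G. f b \<in> N b)"
  using assms
proof (induction "card G" arbitrary: G N rule: less_induct)
  case less
  note fG = less.prems(1) and fN = less.prems(2) and hc = less.prems(3)
  show ?case
  proof (cases "\<exists>S. S \<subset> G \<and> S \<noteq> {} \<and> card S = card (\<Union>(N ` S))")
    case True
    then obtain S where S: "S \<subset> G" "S \<noteq> {}" "card S = card (\<Union>(N ` S))" by auto
    have fS: "finite S" using S fG finite_subset by blast
    define W where "W = \<Union>(N ` S)"
    have fW: "finite W" unfolding W_def using fS fN S by auto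
    have "card S < card G" using fG S(1) by (rule psubset_card_mono)
    then have "\<exists>f. inj_on f S \<and> (\<forall>b\<in>S. f b \<in> N b)"
      using less.hyps[of S N] fS fN hc S by (meson psubsetD subset_trans less_imp_le)
    then obtain f where f: "inj_on f S" "\<forall>b\<in>S. f b \<in> N b" by auto
    \<comment> \<open>Outside \<open>W\<close> Hall's condition survives: apply it to
      \<open>T \<union> S\<close> and subtract \<open>card W = card S\<close>.\<close>
    define N' where "N' b = N b - W" for b
    have "card (G - S) < card G" using S fG
      by (intro psubset_card_mono) auto
    moreover have "card T \<le> card (\<Union>(N' ` T))" if T: "T \<subseteq> G - S" for T
    proof -
      have fT: "finite T" using T fG finite_subset by blast
      have "card T + card S = card (T \<union> S)" using T fT fS by (subst card_Un_disjoint) auto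
      also have "\<dots> \<le> card (\<Union>(N ` (T \<union> S)))" using hc[of "T \<union> S"] T S by auto
      also have "\<Union>(N ` (T \<union> S)) = \<Union>(N' ` T) \<union> W" unfolding N'_def W_def by auto
      also have "card \<dots> \<le> card (\<Union>(N' ` T)) + card W" by (rule card_Un_le)
      finally show ?thesis using S(3) W_def by simp
    qed
    ultimately have "\<exists>g. inj_on g (G - S) \<and> (\<forall>b\<in>G - S. g b \<in> N' b)"
      using less.hyps[of "G - S" N'] fG fN unfolding N'_def by auto
    then obtain g where g: "inj_on g (G - S)" "\<forall>b\<in>G - S. g b \<in> N' b" by auto
    define h where "h b = (if b \<in> S then f b else g b)" for b
    have "inj_on h G"
    proof (rule inj_onI)
      fix x y assume xy: "x \<in> G" "y \<in> G" "h x = h y"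
      have fW': "f b \<in> W" if "b \<in> S" for b using f(2) that unfolding W_def by auto
      have gW': "g b \<notin> W" if "b \<in> G - S" for b using g(2) that unfolding N'_def by auto
      show "x = y"
      proof (cases "x \<in> S"; cases "y \<in> S")
        assume "x \<in> S" "y \<in> S"
        then show ?thesis using xy(3) f(1) unfolding h_def by (simp add: inj_on_eq_iff)
      next
        assume "x \<in> S" "y \<notin> S"
        then show ?thesis using xy fW'[of x] gW'[of y] unfolding h_def by simp
      next
        assume "x \<notin> S" "y \<in> S"
        then show ?thesis using xy fW'[of y] gW'[of x] unfolding h_def by simp
      next
        assume "x \<notin> S" "y \<notin> S"
        then show ?thesis using xy g(1) unfolding h_def by (simp add: inj_on_eq_iff)
      qed
    qed
    moreover have "\<forall>b\<in>G. h b \<in> N b" unfolding h_def using f g unfolding N'_def by auto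
    ultimately show ?thesis by blast
  next
    case noT: False
    show ?thesis
    proof (cases "G = {}")
      case True then show ?thesis by auto
    next
      case False
      then obtain b0 where b0: "b0 \<in> G" by auto
      have "N b0 \<noteq> {}" using hc[of "{b0}"] b0 by auto
      then obtain a0 where a0: "a0 \<in> N b0" by auto
      \<comment> \<open>A nonempty proper subset has at least one neighbour to spare, so removing
        \<open>a0\<close> preserves Hall's condition.\<close>
      define N' where "N' b = N b - {a0}" for b
      have "card (G - {b0}) < card G" using b0 fG by (intro psubset_card_mono) auto
      moreover have "card T \<le> card (\<Union>(N' ` T))" if T: "T \<subseteq> G - {b0}" for T
      proof (cases "T = {}")
        case False
        have fT: "finite T" using T fG finite_subset by blast
        have "T \<subset> G" using T b0 by auto
        then have "card T < card (\<Union>(N ` T))" using noT hc[of T] False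
          by (meson le_neq_implies_less psubset_imp_subset)
        moreover have "\<Union>(N ` T) - {a0} = \<Union>(N' ` T)" unfolding N'_def by auto
        moreover have "card (\<Union>(N ` T)) - 1 \<le> card (\<Union>(N ` T) - {a0})"
          by (simp add: card_Diff_singleton_if)
        ultimately show ?thesis by simp
      qed simp
      ultimately have "\<exists>g. inj_on g (G - {b0}) \<and> (\<forall>b\<in>G - {b0}. g b \<in> N' b)"
        using less.hyps[of "G - {b0}" N'] fG fN unfolding N'_def by auto
      then obtain g where g: "inj_on g (G - {b0})" "\<forall>b\<in>G - {b0}. g b \<in> N' b" by auto
      have "inj_on (g(b0 := a0)) G" using g unfolding N'_def inj_on_def by auto
      moreover have "\<forall>b\<in>G. (g(b0 := a0)) b \<in> N b" using g a0 unfolding N'_def by auto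
      ultimately show ?thesis by blast
    qed
  qed
qed

section \<open>Flats of the zero pattern\<close>

locale zero_pattern =
  fixes m n :: nat and Z :: "(nat \<times> nat) set"
  assumes Z_sub: "Z \<subseteq> positions m n"
begin

definition zcols :: "nat set \<Rightarrow> nat set" where
  "zcols E = {b. \<exists>a. a \<notin> E \<and> (a, b) \<in> Z}"

definition saturable :: "nat set \<Rightarrow> nat set \<Rightarrow> bool" where
  "saturable E G \<longleftrightarrow> (\<exists>A\<subseteq>Z. matching A \<and> fst ` A \<inter> E = {} \<and> snd ` A = G)"

text \<open>Rows \<open>E\<close> with columns \<open>zcols E\<close> always cover \<open>Z\<close>,
  so \<open>j\<close> is the size of a cover. Its columns are matched by zeros, while the rows of
  \<open>E\<close> are left to entries of possibly positive cost.\<close>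

definition preflat :: "nat \<Rightarrow> nat set \<Rightarrow> bool" where
  "preflat j E \<longleftrightarrow> E \<subseteq> {..<m} \<and> card E + card (zcols E) = j \<and> saturable E (zcols E)"

definition flat :: "nat \<Rightarrow> nat set \<Rightarrow> bool" where
  "flat j E \<longleftrightarrow> preflat j E \<and> (\<forall>a\<in>{..<m} - E. saturable (insert a E) (zcols E))"

lemma finite_Z: "finite Z"
  using Z_sub unfolding positions_def by (rule finite_subset) simp

lemma Z_D: "(a, b) \<in> Z \<Longrightarrow> a < m \<and> b < n"
  using Z_sub unfolding positions_def by auto

lemma zcols_sub: "zcols E \<subseteq> {..<n}"
  unfolding zcols_def using Z_D by auto

lemma finite_zcols: "finite (zcols E)"
  using zcols_sub finite_subset by blast

lemma zcols_mono: "E \<subseteq> E' \<Longrightarrow> zcols E' \<subseteq> zcols E"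
  unfolding zcols_def by auto

lemma saturable_hall:
  assumes "finite G" "\<And>S. S \<subseteq> G \<Longrightarrow> card S \<le> card {a. a \<notin> E \<and> (\<exists>b\<in>S. (a, b) \<in> Z)}"
  shows "saturable E G"
proof -
  define N where "N b = {a. a \<notin> E \<and> (a, b) \<in> Z}" for b
  have "\<exists>f. inj_on f G \<and> (\<forall>b\<in>G. f b \<in> N b)"
  proof (rule hall)
    show "finite (N b)" for b
      by (rule finite_subset[of _ "{..<m}"]) (use Z_D in \<open>auto simp: N_def\<close>)
    show "card S \<le> card (\<Union>(N ` S))" if "S \<subseteq> G" for S
    proof -
      have "\<Union>(N ` S) = {a. a \<notin> E \<and> (\<exists>b\<in>S. (a, b) \<in> Z)}" unfolding N_def by auto
      then show ?thesis using assms(2)[OF that] by simp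
    qed
  qed (rule assms(1))
  then obtain f where f: "inj_on f G" "\<forall>b\<in>G. f b \<in> N b" by auto
  define A where "A = (\<lambda>b. (f b, b)) ` G"
  have "A \<subseteq> Z" "fst ` A \<inter> E = {}" using f(2) unfolding A_def N_def by auto
  moreover have "snd ` A = G" unfolding A_def by force
  moreover have "matching A" unfolding matching_def A_def using assms(1) f(1)
    by (auto simp: inj_on_def)
  ultimately show ?thesis unfolding saturable_def by blast
qed

lemma saturableD_card:
  assumes "saturable E G" "S \<subseteq> G"
  shows "card S \<le> card {a. a \<notin> E \<and> (\<exists>b\<in>S. (a, b) \<in> Z)}"
proof -
  obtain A where A: "A \<subseteq> Z" "matching A" "fst ` A \<inter> E = {}" "snd ` A = G"
    using assms(1) unfolding saturable_def by auto
  define B where "B = {p\<in>A. snd p \<in> S}"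
  have mB: "matching B" using A(2) unfolding B_def by (rule matching_subset) auto
  have "snd ` B = S" using A(4) assms(2) unfolding B_def by force
  then have "card S = card (fst ` B)" using matching_card_snd[OF mB] matching_card_fst[OF mB] by simp
  also have "\<dots> \<le> card {a. a \<notin> E \<and> (\<exists>b\<in>S. (a, b) \<in> Z)}"
  proof (rule card_mono)
    show "finite {a. a \<notin> E \<and> (\<exists>b\<in>S. (a, b) \<in> Z)}"
      by (rule finite_subset[of _ "{..<m}"]) (use Z_D in auto)
    show "fst ` B \<subseteq> {a. a \<notin> E \<and> (\<exists>b\<in>S. (a, b) \<in> Z)}"
      using A unfolding B_def by fastforce
  qed
  finally show ?thesis .
qed

text \<open>
  If row \<open>a\<close> cannot be avoided, some column set \<open>S\<close> is tight by Hall's theorem; all rows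
  with zeros in \<open>S\<close> are moved into \<open>E\<close>.
\<close>
lemma preflat_step:
  assumes pre: "preflat j E" and a: "a < m" "a \<notin> E" and nsat: "\<not> saturable (insert a E) (zcols E)"
  shows "\<exists>E'. E \<subseteq> E' \<and> preflat j E' \<and> zcols E' \<subset> zcols E \<and>
    (\<exists>A\<subseteq>Z. matching A \<and> fst ` A = E' - E \<and> snd ` A = zcols E - zcols E')"
proof -
  have sat: "saturable E (zcols E)" and j: "card E + card (zcols E) = j" and Em: "E \<subseteq> {..<m}"
    using pre unfolding preflat_def by auto
  obtain S where S: "S \<subseteq> zcols E"
    "\<not> card S \<le> card {x. x \<notin> insert a E \<and> (\<exists>b\<in>S. (x, b) \<in> Z)}"
    using saturable_hall[OF finite_zcols] nsat by blast
  define W where "W = {x. x \<notin> E \<and> (\<exists>b\<in>S. (x, b) \<in> Z)}"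
  have fW: "finite W" unfolding W_def by (rule finite_subset[of _ "{..<m}"]) (use Z_D in auto)
  have Wm: "W \<subseteq> {..<m}" unfolding W_def using Z_D by auto
  have "{x. x \<notin> insert a E \<and> (\<exists>b\<in>S. (x, b) \<in> Z)} = W - {a}" unfolding W_def by auto
  then have lt: "card (W - {a}) < card S" using S(2) by simp
  have cS: "card S \<le> card W" using saturableD_card[OF sat S(1)] unfolding W_def .
  \<comment> \<open>Hall's condition fails only after \<open>a\<close> is forbidden, which costs at
    most one row of \<open>W\<close>; hence \<open>S\<close> is exactly tight.\<close>
  have WS: "card W = card S" using lt cS fW card_Diff_singleton_if[of W a] by (auto split: if_splits)
  have Sne: "S \<noteq> {}" using lt by auto
  have fS: "finite S" using S(1) finite_zcols finite_subset by blast
  obtain A where A: "A \<subseteq> Z" "matching A" "fst ` A \<inter> E = {}" "snd ` A = zcols E"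
    using sat unfolding saturable_def by auto
  define A1 where "A1 = {p\<in>A. snd p \<in> S}"
  define A2 where "A2 = {p\<in>A. snd p \<notin> S}"
  have mA: "matching A1" "matching A2" using A(2) unfolding A1_def A2_def
    by (auto intro: matching_subset)
  have sA1: "snd ` A1 = S" using A(4) S(1) unfolding A1_def by force
  have sA2: "snd ` A2 = zcols E - S" using A(4) unfolding A2_def by force
  \<comment> \<open>By equality of cardinalities the edges of \<open>A\<close> into \<open>S\<close>
    use up all of \<open>W\<close>, so the remaining edges avoid \<open>W\<close>.\<close>
  have "fst ` A1 \<subseteq> W" using A unfolding A1_def W_def by fastforce
  moreover have "card (fst ` A1) = card W"
    using matching_card_fst[OF mA(1)] matching_card_snd[OF mA(1)] sA1 WS by simp
  ultimately have fA1: "fst ` A1 = W" using fW by (simp add: card_subset_eq)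
  have disj: "fst ` A2 \<inter> W = {}"
  proof -
    have False if x: "(x, b) \<in> A2" "x \<in> W" for x b
    proof -
      obtain b' where "(x, b') \<in> A1" using x(2) fA1 by force
      then have "b = b'" "b' \<in> S" "b \<notin> S"
        using x(1) matching_fstD[OF A(2)] unfolding A1_def A2_def by auto
      then show False by simp
    qed
    then show ?thesis by auto
  qed
  define E' where "E' = E \<union> W"
  have z': "zcols E' = zcols E - S"
  proof
    show "zcols E' \<subseteq> zcols E - S" unfolding zcols_def E'_def W_def by auto
    show "zcols E - S \<subseteq> zcols E'"
    proof
      fix b assume "b \<in> zcols E - S"
      then obtain x where "(x, b) \<in> A2" using sA2 by force
      then have "(x, b) \<in> Z" "x \<notin> E" "x \<notin> W" using A disj unfolding A2_def by force+
      then show "b \<in> zcols E'" unfolding zcols_def E'_def by auto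
    qed
  qed
  have "card E' = card E + card W"
    unfolding E'_def using fW Em finite_subset W_def by (subst card_Un_disjoint) auto
  moreover have "card (zcols E') = card (zcols E) - card S"
    unfolding z' using S(1) fS by (simp add: card_Diff_subset)
  moreover have "card S \<le> card (zcols E)" using S(1) finite_zcols by (rule card_mono[rotated])
  ultimately have "card E' + card (zcols E') = j" using j WS by simp
  moreover have "saturable E' (zcols E')"
    unfolding saturable_def
  proof (intro exI[of _ A2] conjI)
    show "A2 \<subseteq> Z" using A unfolding A2_def by auto
    show "fst ` A2 \<inter> E' = {}" using A(3) disj unfolding E'_def A2_def by auto
    show "snd ` A2 = zcols E'" using sA2 z' by simp
  qed (rule mA(2))
  moreover have "E' \<subseteq> {..<m}" unfolding E'_def using Em Wm by auto
  ultimately have "preflat j E'" unfolding preflat_def by simp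
  moreover have "zcols E' \<subset> zcols E" using z' S(1) Sne by auto
  moreover have "E' - E = W" unfolding E'_def W_def by auto
  moreover have "zcols E - zcols E' = S" using z' S(1) by auto
  moreover have "A1 \<subseteq> Z" using A(1) unfolding A1_def by auto
  ultimately show ?thesis using mA(1) fA1 sA1 E'_def by (intro exI[of _ E']) blast
qed

text \<open>Rows that cannot be avoided are absorbed until none remains; each step shrinks
  \<open>zcols\<close>. The zero matchings of the steps are disjoint in rows and columns and add up
  to one between the new rows and the lost columns, which later pays for the enlargement.\<close>

lemma flat_closure:
  assumes "preflat j E"
  shows "\<exists>E'. E \<subseteq> E' \<and> flat j E' \<and>
    (\<exists>A\<subseteq>Z. matching A \<and> fst ` A = E' - E \<and> snd ` A = zcols E - zcols E')"
  using assms
proof (induction "card (zcols E)" arbitrary: E rule: less_induct)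
  case less
  show ?case
  proof (cases "flat j E")
    case True
    then show ?thesis by (intro exI[of _ E] conjI exI[of _ "{}"]) (auto simp: matching_def)
  next
    case False
    then obtain a where a: "a < m" "a \<notin> E" "\<not> saturable (insert a E) (zcols E)"
      using less.prems unfolding flat_def by auto
    obtain E1 A1 where E1: "E \<subseteq> E1" "preflat j E1" "zcols E1 \<subset> zcols E"
      "A1 \<subseteq> Z" "matching A1" "fst ` A1 = E1 - E" "snd ` A1 = zcols E - zcols E1"
      using preflat_step[OF less.prems a] by blast
    have "card (zcols E1) < card (zcols E)" using E1(3) finite_zcols by (rule psubset_card_mono[rotated])
    then obtain E' A where E': "E1 \<subseteq> E'" "flat j E'" "A \<subseteq> Z" "matching A"
      "fst ` A = E' - E1" "snd ` A = zcols E1 - zcols E'"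
      using less.hyps[OF _ E1(2)] by blast
    have "matching (A1 \<union> A)"
      by (rule matching_Un) (use E1 E' in auto)
    moreover have "fst ` (A1 \<union> A) = E' - E" using E1 E' by (auto simp: image_Un)
    moreover have "snd ` (A1 \<union> A) = zcols E - zcols E'"
      using E1 E' zcols_mono[OF E'(1)] by (auto simp: image_Un)
    ultimately show ?thesis using E1 E' by (intro exI[of _ E'] conjI exI[of _ "A1 \<union> A"]) auto
  qed
qed

text \<open>Koenig's theorem, by Hall's theorem on both sides of a smallest cover
  \<open>(E, F)\<close>: exchanging a violating set of lines for the lines that meet its otherwise
  uncovered zeros would give a smaller cover.\<close>

lemma koenig:
  obtains E A B where "E \<subseteq> {..<m}" "A \<subseteq> Z" "matching A" "fst ` A = E" "snd ` A \<inter> zcols E = {}"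
    "B \<subseteq> Z" "matching B" "fst ` B \<inter> E = {}" "snd ` B = zcols E"
    "preflat (card E + card (zcols E)) E"
proof -
  define cov where "cov E F \<longleftrightarrow> E \<subseteq> {..<m} \<and> F \<subseteq> {..<n} \<and> (\<forall>(a, b)\<in>Z. a \<in> E \<or> b \<in> F)" for E F
  have "cov {..<m} {}" unfolding cov_def using Z_D by auto
  then have "\<exists>s. \<exists>E F. cov E F \<and> card E + card F = s" by blast
  from exists_least_iff[THEN iffD1, OF this] obtain s where
    s: "\<exists>E F. cov E F \<and> card E + card F = s" "\<And>t. t < s \<Longrightarrow> \<not> (\<exists>E F. cov E F \<and> card E + card F = t)"
    by blast
  then obtain E F where EF: "cov E F" "card E + card F = s" by auto
  have min: "s \<le> card E' + card F'" if "cov E' F'" for E' F'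
    using s(2) that not_less by blast
  have fin: "finite E" "finite F" using EF unfolding cov_def by (auto intro: finite_subset)
  have "saturable E F"
  proof (rule saturable_hall[OF fin(2)])
    fix S assume S: "S \<subseteq> F"
    define W where "W = {a. a \<notin> E \<and> (\<exists>b\<in>S. (a, b) \<in> Z)}"
    have "cov (E \<union> W) (F - S)" using EF(1) unfolding cov_def W_def using Z_D by auto
    then have "s \<le> card (E \<union> W) + card (F - S)" by (rule min)
    also have "\<dots> \<le> card E + card W + (card F - card S)"
      using card_Un_le[of E W] card_Diff_subset[OF finite_subset[OF S fin(2)] S] by simp
    finally have "card S \<le> card W" using EF(2) card_mono[OF fin(2) S] by linarith
    then show "card S \<le> card {a. a \<notin> E \<and> (\<exists>b\<in>S. (a, b) \<in> Z)}" unfolding W_def .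
  qed
  then obtain B where B: "B \<subseteq> Z" "matching B" "fst ` B \<inter> E = {}" "snd ` B = F"
    unfolding saturable_def by auto
  have zF: "zcols E = F"
  proof
    show "zcols E \<subseteq> F" using EF(1) unfolding cov_def zcols_def by auto
    show "F \<subseteq> zcols E"
    proof
      fix b assume "b \<in> F"
      then obtain a where "(a, b) \<in> B" using B(4) by force
      then show "b \<in> zcols E" using B(1,3) unfolding zcols_def by force
    qed
  qed
  define N where "N a = {b. b \<notin> F \<and> (a, b) \<in> Z}" for a
  have "\<exists>f. inj_on f E \<and> (\<forall>a\<in>E. f a \<in> N a)"
  proof (rule hall[OF fin(1)])
    show "finite (N a)" for a unfolding N_def by (rule finite_subset[of _ "{..<n}"]) (use Z_D in auto)
    fix S assume S: "S \<subseteq> E"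
    define W where "W = \<Union>(N ` S)"
    have "cov (E - S) (F \<union> W)" using EF(1) unfolding cov_def W_def N_def using Z_D by auto
    then have "s \<le> card (E - S) + card (F \<union> W)" by (rule min)
    also have "\<dots> \<le> (card E - card S) + (card F + card W)"
      using card_Un_le[of F W] card_Diff_subset[OF finite_subset[OF S fin(1)] S] by simp
    finally have "card S \<le> card W" using EF(2) card_mono[OF fin(1) S] by linarith
    then show "card S \<le> card (\<Union>(N ` S))" unfolding W_def .
  qed
  then obtain f where f: "inj_on f E" "\<forall>a\<in>E. f a \<in> N a" by auto
  define A where "A = (\<lambda>a. (a, f a)) ` E"
  have "A \<subseteq> Z" "snd ` A \<inter> zcols E = {}" using f(2) unfolding A_def N_def zF by auto
  moreover have "fst ` A = E" unfolding A_def by force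
  moreover have "matching A" unfolding matching_def A_def using fin(1) f(1)
    by (auto simp: inj_on_def)
  moreover have "preflat (card E + card (zcols E)) E"
    unfolding preflat_def using B EF zF unfolding cov_def saturable_def by auto
  ultimately show ?thesis using that[of E A B] B EF(1) zF unfolding cov_def by blast
qed

end

section \<open>Random orderings of the rows\<close>

text \<open>The probability that a given set of \<open>i\<close> elements is exactly the set of
  predecessors of a fixed element in a uniformly random ordering of \<open>N\<close>
  elements.\<close>

definition wt :: "nat \<Rightarrow> nat \<Rightarrow> real" where
  "wt N i = 1 / (real N * real ((N - 1) choose i))"

text \<open>Delete one element other than the fixed one from the ordering: it stood either after or
  before the fixed element, which accounts for the two terms.\<close>

lemma wt_add:
  assumes "i < N"
  shows "wt (Suc N) i + wt (Suc N) (Suc i) = wt N i"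
proof -
  obtain M where N: "N = Suc M" using assms by (cases N) auto
  have i: "i \<le> M" using assms N by simp
  define c where "c = real (M choose i)"
  have c: "c > 0" unfolding c_def using i by simp
  have "Suc i * (Suc M choose Suc i) = Suc M * (M choose i)" by (rule Suc_times_binomial)
  then have "real (Suc i) * real (Suc M choose Suc i) = real (Suc M) * c"
    unfolding c_def by (metis of_nat_mult)
  then have 1: "real (Suc M choose Suc i) = real (Suc M) * c / real (Suc i)"
    by (simp add: field_simps)
  have "(Suc M - i) * (Suc M choose i) = Suc M * (M choose i)"
    using binomial_absorb_comp[of "Suc M" i] by simp
  then have "real (Suc M - i) * real (Suc M choose i) = real (Suc M) * c"
    unfolding c_def by (metis of_nat_mult)
  then have 2: "real (Suc M choose i) = real (Suc M) * c / real (Suc M - i)"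
    using i by (simp add: field_simps)
  have "wt (Suc N) i + wt (Suc N) (Suc i)
      = (real (Suc M - i) + real (Suc i)) / (real (Suc (Suc M)) * (real (Suc M) * c))"
    unfolding wt_def N diff_Suc_1 1 2 by (simp add: add_divide_distrib)
  also have "real (Suc M - i) + real (Suc i) = real (Suc (Suc M))" using i by simp
  also have "real (Suc (Suc M)) / (real (Suc (Suc M)) * (real (Suc M) * c)) = 1 / (real (Suc M) * c)"
    by simp
  finally show ?thesis unfolding wt_def N c_def by simp
qed

text \<open>Condition on the first element of the ordering: it is one of the \<open>Suc i\<close>
  predecessors, each with probability \<open>1 / real (Suc N)\<close>, and the other
  \<open>i\<close> are the predecessors in the remaining ordering.\<close>

lemma wt_Suc:
  assumes "i < N"
  shows "real (Suc N) * wt (Suc N) (Suc i) = real (Suc i) * wt N i"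
proof -
  obtain M where N: "N = Suc M" using assms by (cases N) auto
  have i: "i \<le> M" using assms N by simp
  have "Suc i * (Suc M choose Suc i) = Suc M * (M choose i)" by (rule Suc_times_binomial)
  then have "real (Suc i) * real (Suc M choose Suc i) = real (Suc M) * real (M choose i)"
    by (metis of_nat_mult)
  moreover have "real (Suc M choose Suc i) > 0" "real (M choose i) > 0"
    using i by (auto simp del: binomial_Suc_Suc)
  ultimately show ?thesis unfolding wt_def N diff_Suc_1
    by (simp add: field_simps del: binomial_Suc_Suc of_nat_Suc)
qed

section \<open>Extendable row sets and hitting probabilities\<close>

locale rap_pattern = zero_pattern +
  fixes k r :: nat
  assumes k_pos: "1 \<le> k" and k_m: "k \<le> m" and k_n: "k \<le> n"
    and r_m: "r < m" and r_free: "\<And>j. (r, j) \<notin> Z"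
begin

definition extendable :: "nat set \<Rightarrow> bool" where
  "extendable R \<longleftrightarrow> partial_s_cover (k - 1) m n Z (Inl ` R)"

text \<open>
  The probability, in a uniformly random ordering of the rows not in \<open>E\<close>, that the set \<open>R\<close>
  of rows preceding \<open>r\<close> satisfies \<open>extendable (E \<union> R)\<close>.
\<close>
definition hit :: "nat set \<Rightarrow> real" where
  "hit E = (if r \<in> E then 1
     else \<Sum>R\<in>Pow ({..<m} - E - {r}). if extendable (E \<union> R) then wt (m - card E) (card R) else 0)"

text \<open>A cover with too few lines can be padded to exactly \<open>k - 1\<close>, since there
  are \<open>m + n \<ge> k - 1\<close> lines.\<close>

lemma extendableI:
  assumes "L \<subseteq> {..<m} <+> {..<n}" "covers L Z" "card L \<le> k - 1" "Inl ` R \<subseteq> L"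
  shows "extendable R"
proof -
  have "k - 1 \<le> card ({..<m} <+> {..<n})" using k_m by (simp add: card_Plus)
  then obtain L' where L': "L \<subseteq> L'" "L' \<subseteq> {..<m} <+> {..<n}" "card L' = k - 1"
    using exists_subset_between[of L "k - 1" "{..<m} <+> {..<n}"] assms by auto
  moreover have "covers L' Z" using assms(2) L'(1) unfolding covers_def by blast
  ultimately show ?thesis
    unfolding extendable_def partial_s_cover_def s_cover_def using assms(4) by blast
qed

lemma extendableE:
  assumes "extendable R"
  obtains L where "L \<subseteq> {..<m} <+> {..<n}" "covers L Z" "card L = k - 1" "Inl ` R \<subseteq> L" "finite L"
proof -
  obtain L where L: "L \<subseteq> {..<m} <+> {..<n}" "covers L Z" "card L = k - 1" "Inl ` R \<subseteq> L"
    using assms unfolding extendable_def partial_s_cover_def s_cover_def by blast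
  moreover have "finite L" using L(1) by (rule finite_subset) simp
  ultimately show ?thesis using that by blast
qed

lemma extendable_mono: "extendable R' \<Longrightarrow> R \<subseteq> R' \<Longrightarrow> extendable R"
  unfolding extendable_def partial_s_cover_def by blast

lemma extendable_card:
  assumes "extendable R"
  shows "card R \<le> k - 1"
proof -
  obtain L where L: "L \<subseteq> {..<m} <+> {..<n}" "covers L Z" "card L = k - 1" "Inl ` R \<subseteq> L" "finite L"
    using assms by (rule extendableE)
  have "card R = card (Inl ` R :: (nat + nat) set)" by (simp add: card_image)
  also have "\<dots> \<le> card L" using L by (intro card_mono)
  finally show ?thesis using L by simp
qed

text \<open>Weak duality: each edge of \<open>A\<close> lies on a line of \<open>L\<close>, and
  distinct edges of a matching share no line. Counting only lines through \<open>A\<close> permits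
  local exchanges in a cover.\<close>

lemma matching_le_cover:
  assumes A: "A \<subseteq> Z" "matching A" and L: "covers L Z" "finite L"
  shows "card A \<le> card (L \<inter> (Inl ` fst ` A \<union> Inr ` snd ` A))"
proof (rule card_inj_on_le)
  let ?h = "\<lambda>p. if Inl (fst p) \<in> L then Inl (fst p) else Inr (snd p)"
  show "inj_on ?h A"
  proof (rule inj_onI)
    fix p q assume pq: "p \<in> A" "q \<in> A" "?h p = ?h q"
    then have "fst p = fst q \<or> snd p = snd q" by (auto split: if_splits)
    then show "p = q" using A(2) pq unfolding matching_def by (auto dest: inj_onD)
  qed
  show "?h ` A \<subseteq> L \<inter> (Inl ` fst ` A \<union> Inr ` snd ` A)"
  proof (rule image_subsetI)
    fix p assume p: "p \<in> A"
    then have "(fst p, snd p) \<in> Z" using A(1) by auto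
    then have "Inl (fst p) \<in> L \<or> Inr (snd p) \<in> L" using L(1) unfolding covers_def by blast
    then show "?h p \<in> L \<inter> (Inl ` fst ` A \<union> Inr ` snd ` A)" using p by auto
  qed
qed (use L(2) in auto)

text \<open>
  In a cover containing \<open>E\<close> the rows \<open>E' - E\<close> can replace the columns of \<open>A\<close>, since every
  edge of \<open>A\<close> is covered and these columns have no zero outside \<open>E'\<close>.
\<close>
lemma extendable_closure:
  assumes E: "E \<subseteq> E'" "E' \<subseteq> {..<m}" and A: "A \<subseteq> Z" "matching A" "fst ` A = E' - E"
    and col: "\<And>a b. (a, b) \<in> Z \<Longrightarrow> b \<in> snd ` A \<Longrightarrow> a \<in> E'"
    and ext: "extendable (E \<union> R)"
  shows "extendable (E' \<union> R)"
proof -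
  obtain L where L: "L \<subseteq> {..<m} <+> {..<n}" "covers L Z" "card L = k - 1"
    "Inl ` (E \<union> R) \<subseteq> L" "finite L" using ext by (rule extendableE)
  define X :: "(nat + nat) set" where "X = Inl ` fst ` A \<union> Inr ` snd ` A"
  define L' where "L' = (L - X) \<union> Inl ` fst ` A"
  \<comment> \<open>\<open>L\<close> has at least \<open>card A\<close> lines in \<open>X\<close>,
    so exchanging them for the \<open>card A\<close> rows of \<open>A\<close> does not enlarge the
    cover.\<close>
  have "card A \<le> card (L \<inter> X)" unfolding X_def by (rule matching_le_cover[OF A(1,2) L(2,5)])
  moreover have "card L = card (L - X) + card (L \<inter> X)"
    using L(5) by (metis card_Int_Diff add.commute)
  moreover have "card L' \<le> card (L - X) + card A"
  proof -
    have "card (Inl ` fst ` A :: (nat + nat) set) = card A"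
      using matching_card_fst[OF A(2)] by (simp add: card_image)
    then show ?thesis unfolding L'_def using card_Un_le by metis
  qed
  ultimately have cL': "card L' \<le> k - 1" using L(3) by linarith
  have sub: "L' \<subseteq> {..<m} <+> {..<n}" unfolding L'_def using L(1) A(3) E(2) by auto
  have EL: "Inl ` (E' \<union> R) \<subseteq> L'"
  proof
    fix x :: "nat + nat" assume "x \<in> Inl ` (E' \<union> R)"
    then obtain a where a: "x = Inl a" "a \<in> E' \<or> a \<in> R" by auto
    show "x \<in> L'"
    proof (cases "a \<in> fst ` A")
      case True then show ?thesis unfolding L'_def a by auto
    next
      case False
      then have "a \<in> E \<union> R" using a(2) A(3) by auto
      then show ?thesis using False L(4) unfolding L'_def X_def a by auto
    qed
  qed
  have "covers L' Z" unfolding covers_def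
  proof clarify
    fix a b assume ab: "(a, b) \<in> Z" "Inr b \<notin> L'"
    show "Inl a \<in> L'"
    proof (cases "a \<in> E'")
      case True then show ?thesis using EL by auto
    next
      case False
      then have "b \<notin> snd ` A" using col[OF ab(1)] by blast
      then have "Inr b \<notin> L" using ab(2) unfolding L'_def X_def by auto
      then have "Inl a \<in> L" using L(2) ab(1) unfolding covers_def by auto
      moreover have "a \<notin> fst ` A" using False A(3) by auto
      ultimately show ?thesis unfolding L'_def X_def by auto
    qed
  qed
  then show ?thesis using sub cL' EL by (intro extendableI)
qed

lemma sum_Pow_insert:
  fixes f :: "nat set \<Rightarrow> real"
  assumes "finite V" "l \<notin> V"
  shows "sum f (Pow (insert l V)) = (\<Sum>R\<in>Pow V. f R + f (insert l R))"
proof -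
  have "sum f (Pow (insert l V)) = sum f (Pow V) + sum f (insert l ` Pow V)"
    unfolding Pow_insert using assms by (intro sum.union_disjoint) auto
  also have "sum f (insert l ` Pow V) = (\<Sum>R\<in>Pow V. f (insert l R))"
    using assms by (subst sum.reindex) (auto simp: inj_on_def)
  finally show ?thesis by (simp add: sum.distrib)
qed

text \<open>A row \<open>l\<close> that is free to add can be deleted from the random ordering:
  whether it precedes \<open>r\<close> does not affect extendability, and the terms for
  \<open>R\<close> and \<open>insert l R\<close> combine by \<open>wt_add\<close>.\<close>

lemma hit_insert:
  assumes E: "E \<subseteq> {..<m}" "r \<notin> E" and l: "l < m" "l \<notin> E" "l \<noteq> r"
    and loop: "\<And>R. extendable (E \<union> R) \<Longrightarrow> extendable (insert l E \<union> R)"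
  shows "hit (insert l E) = hit E"
proof -
  define V where "V = {..<m} - insert l E - {r}"
  define N where "N = m - card (insert l E)"
  have fE: "finite E" using E finite_subset by blast
  have V: "{..<m} - E - {r} = insert l V" "l \<notin> V" "finite V" unfolding V_def using l by auto
  have cV: "card V < N"
  proof -
    have "V \<subset> {..<m} - insert l E" using E l r_m unfolding V_def by auto
    then have "card V < card ({..<m} - insert l E)" by (intro psubset_card_mono) auto
    also have "\<dots> = N" unfolding N_def using E l fE by (subst card_Diff_subset) auto
    finally show ?thesis .
  qed
  have N: "m - card E = Suc N"
    using cV fE l(2) unfolding N_def by simp
  have loop': "extendable (insert l (E \<union> R)) = extendable (E \<union> R)" for R
    using loop[of R] extendable_mono[of "insert l (E \<union> R)" "E \<union> R"] by auto
  have "hit E = (\<Sum>R\<in>Pow V.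
      (if extendable (E \<union> R) then wt (Suc N) (card R) else 0) +
      (if extendable (E \<union> insert l R) then wt (Suc N) (card (insert l R)) else 0))"
    unfolding hit_def N V(1) using E(2) by (simp add: sum_Pow_insert[OF V(3,2)])
  also have "\<dots> = (\<Sum>R\<in>Pow V. if extendable (insert l E \<union> R) then wt N (card R) else 0)"
  proof (rule sum.cong)
    fix R assume R: "R \<in> Pow V"
    then have "finite R" "l \<notin> R" using V finite_subset by auto
    then have "card (insert l R) = Suc (card R)" by simp
    moreover have "card R < N" using R V(3) cV card_mono[of V R] by auto
    ultimately show "(if extendable (E \<union> R) then wt (Suc N) (card R) else 0) +
      (if extendable (E \<union> insert l R) then wt (Suc N) (card (insert l R)) else 0) =
      (if extendable (insert l E \<union> R) then wt N (card R) else 0)"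
      using loop'[of R] by (simp add: wt_add)
  qed simp
  also have "\<dots> = hit (insert l E)"
    unfolding hit_def N_def V_def using E(2) l(3) by simp
  finally show ?thesis by simp
qed

text \<open>By \<open>extendable_closure\<close> the new rows are free to add, so they can be
  inserted one by one. Row \<open>r\<close> is not among them, since each of them carries a zero of
  \<open>A\<close>.\<close>

lemma hit_closure:
  assumes E: "E \<subseteq> E'" "E' \<subseteq> {..<m}" and A: "A \<subseteq> Z" "matching A" "fst ` A = E' - E"
    and col: "\<And>a b. (a, b) \<in> Z \<Longrightarrow> b \<in> snd ` A \<Longrightarrow> a \<in> E'"
  shows "hit E' = hit E"
proof -
  have rA: "r \<notin> E' - E" using A(1,3) r_free by force
  show ?thesis
  proof (cases "r \<in> E")
    case True
    then show ?thesis using E unfolding hit_def by auto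
  next
    case False
    have fin: "finite (E' - E)" using E finite_subset by blast
    have "hit (E \<union> S) = hit E" if "S \<subseteq> E' - E" for S
      using finite_subset[OF that fin] that
    proof (induction S rule: finite_induct)
      case (insert l S)
      have "hit (insert l (E \<union> S)) = hit (E \<union> S)"
      proof (rule hit_insert)
        fix R assume "extendable (E \<union> S \<union> R)"
        then have "extendable (E \<union> R)" by (rule extendable_mono) auto
        from extendable_closure[OF E A _ this] have "extendable (E' \<union> R)" using col by blast
        then show "extendable (insert l (E \<union> S) \<union> R)"
          by (rule extendable_mono) (use insert.prems E in auto)
      qed (use insert E False rA in auto)
      then show ?case using insert by simp
    qed simp
    from this[of "E' - E"] show ?thesis using E(1) by (simp add: Un_absorb1)
  qed
qed

text \<open>Condition on the first row \<open>a\<close> of a uniformly random ordering of the rows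
  outside \<open>E\<close>. The case that \<open>r\<close> itself comes first contributes
  \<open>1\<close>, which is where \<open>extendable E\<close> enters.\<close>

lemma hit_first:
  assumes E: "E \<subseteq> {..<m}" and ext: "extendable E"
  shows "real (m - card E) * hit E = (\<Sum>a\<in>{..<m} - E. hit (insert a E))"
proof (cases "r \<in> E")
  case True
  have "card ({..<m} - E) = m - card E" using E finite_subset by (subst card_Diff_subset) auto
  then show ?thesis using True unfolding hit_def by simp
next
  case False
  define V where "V = {..<m} - E - {r}"
  define f where "f i = wt (m - Suc (card E)) i" for i
  have fE: "finite E" using E finite_subset by blast
  have V: "finite V" "r \<notin> V" "{..<m} - E = insert r V" unfolding V_def using r_m False by auto
  have "m - card E = card ({..<m} - E)" using E fE by (subst card_Diff_subset) auto
  then have N: "m - card E = Suc (card V)" using V by simp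
  then have N': "m - Suc (card E) = card V" by simp
  have term0: "real (m - card E) * wt (m - card E) 0 = 1" unfolding wt_def N by simp
  have eq: "insert b (E \<union> (R - {b})) = E \<union> R" if "b \<in> R" for b R
    using that by blast
  have termS: "real (m - card E) * wt (m - card E) (card R) = (\<Sum>a\<in>R. f (card (R - {a})))"
    if R: "R \<in> Pow V - {{}}" for R
  proof -
    have fR: "finite R" using R V finite_subset by auto
    then obtain i where i: "card R = Suc i" using R by (metis Diff_iff card_eq_0_iff insertCI not0_implies_Suc)
    have "card R \<le> card V" using R V by (auto intro: card_mono)
    then have "i < card V" using i by simp
    then have "real (m - card E) * wt (m - card E) (card R) = real (Suc i) * f i"
      unfolding N f_def N' i by (rule wt_Suc)
    moreover have "f (card (R - {a})) = f i" if "a \<in> R" for a using that fR i by simp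
    ultimately show ?thesis using i by simp
  qed
  define g where
    "g R = (if extendable (E \<union> R) then real (m - card E) * wt (m - card E) (card R) else 0)" for R
  have "real (m - card E) * hit E = sum g (Pow V)"
    unfolding hit_def V_def g_def using False by (simp add: sum_distrib_left if_distrib cong: if_cong)
  also have "\<dots> = g {} + sum g (Pow V - {{}})"
    using V(1) by (intro sum.remove) auto
  also have "g {} = 1" unfolding g_def using ext by (simp only: Un_empty_right card.empty term0 if_True)
  also have "sum g (Pow V - {{}})
    = (\<Sum>R\<in>Pow V - {{}}. \<Sum>a\<in>R. if extendable (E \<union> R) then f (card (R - {a})) else 0)"
  proof (rule sum.cong)
    fix R assume "R \<in> Pow V - {{}}"
    then show "g R = (\<Sum>a\<in>R. if extendable (E \<union> R) then f (card (R - {a})) else 0)"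
      unfolding g_def by (simp only: termS) simp
  qed simp
  also have "\<dots> = (\<Sum>(R, a)\<in>Sigma (Pow V - {{}}) (\<lambda>R. R). if extendable (E \<union> R) then f (card (R - {a})) else 0)"
    by (rule sum.Sigma) (use V(1) finite_subset in blast)+
  \<comment> \<open>A predecessor set with a chosen first member \<open>a\<close> corresponds to
    \<open>a\<close> together with the predecessors in the remaining ordering.\<close>
  also have "\<dots> = (\<Sum>(a, R)\<in>Sigma V (\<lambda>a. Pow (V - {a})). if extendable (insert a E \<union> R) then f (card R) else 0)"
    by (rule sum.reindex_bij_witness[of _ "\<lambda>(a, R). (insert a R, a)" "\<lambda>(R, a). (a, R - {a})"])
      (auto simp: insert_absorb eq)
  also have "\<dots> = (\<Sum>a\<in>V. \<Sum>R\<in>Pow (V - {a}). if extendable (insert a E \<union> R) then f (card R) else 0)"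
    by (rule sum.Sigma[symmetric]) (use V(1) in auto)
  also have "\<dots> = (\<Sum>a\<in>V. hit (insert a E))"
  proof (rule sum.cong)
    fix a assume a: "a \<in> V"
    then have e: "{..<m} - insert a E - {r} = V - {a}" "card (insert a E) = Suc (card E)" "r \<noteq> a"
      using fE unfolding V_def by auto
    then show "(\<Sum>R\<in>Pow (V - {a}). if extendable (insert a E \<union> R) then f (card R) else 0) = hit (insert a E)"
      unfolding hit_def f_def e(1,2) using False e(3) by simp
  qed simp
  also have "1 = hit (insert r E)" unfolding hit_def by simp
  finally show ?thesis using V by simp
qed

text \<open>The possible predecessor sets of \<open>r\<close> are grouped by size; sizes stop at
  \<open>k - 1\<close> because an extendable set lies in a cover with \<open>k - 1\<close>
  lines.\<close>

lemma hit_empty: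
  "hit {} = 1 / real m * (\<Sum>i = 0..k - 1. real (d_bar_row k m n Z r i) / real ((m - 1) choose i))"
proof -
  define S where "S = {R. R \<subseteq> {..<m} - {r} \<and> extendable R}"
  have fS: "finite S" unfolding S_def by (rule finite_subset[of _ "Pow {..<m}"]) auto
  have cS: "card ` S \<subseteq> {0..k - 1}"
    using extendable_card unfolding S_def by (intro image_subsetI) simp
  have "hit {} = (\<Sum>R\<in>S. wt m (card R))"
    unfolding hit_def S_def by (simp add: sum.If_cases Int_def Pow_def)
  also have "\<dots> = (\<Sum>i = 0..k - 1. \<Sum>R\<in>{R \<in> S. card R = i}. wt m (card R))"
    by (rule sum.group[symmetric, OF fS _ cS]) simp
  also have "\<dots> = (\<Sum>i = 0..k - 1. real (d_bar_row k m n Z r i) * wt m i)"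
  proof (rule sum.cong)
    fix i
    have "{L. partial_s_cover (k - 1) m n Z L \<and>
        card {a. Inl a \<in> L} = i \<and> {b. Inr b \<in> L} = {} \<and> Inl r \<notin> L}
      = image Inl ` {R \<in> S. card R = i}" (is "?X = ?Y")
    proof (intro equalityI subsetI)
      fix L assume "L \<in> ?X"
      then have L: "partial_s_cover (k - 1) m n Z L" "card {a. Inl a \<in> L} = i"
        "{b. Inr b \<in> L} = {}" "Inl r \<notin> L" by simp_all
      define R where "R = {a. Inl a \<in> L}"
      have noInr: "Inr b \<notin> L" for b using L(3) by blast
      have LR: "L = Inl ` R"
      proof (rule set_eqI)
        fix x show "x \<in> L \<longleftrightarrow> x \<in> Inl ` R"
          unfolding R_def using noInr by (cases x) (simp_all add: image_iff)
      qed
      have "L \<subseteq> {..<m} <+> {..<n}"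
        using L(1) unfolding partial_s_cover_def s_cover_def by blast
      then have "R \<subseteq> {..<m}" unfolding R_def by blast
      moreover have "r \<notin> R" using L(4) unfolding R_def by simp
      moreover have "extendable R" unfolding extendable_def using L(1) LR by simp
      ultimately have "R \<in> {R \<in> S. card R = i}" using L(2) unfolding S_def R_def by blast
      then show "L \<in> ?Y" using LR by blast
    next
      fix L assume "L \<in> ?Y"
      then obtain R where R: "L = Inl ` R" "R \<in> S" "card R = i" by blast
      have "{a. Inl a \<in> L} = R" "{b. Inr b \<in> L} = {}" unfolding R(1) by blast+
      moreover have "Inl r \<notin> L" "partial_s_cover (k - 1) m n Z L"
        using R(2) unfolding R(1) S_def extendable_def by blast+
      ultimately show "L \<in> ?X" using R(3) by (simp only: mem_Collect_eq simp_thms)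
    qed
    then have "d_bar_row k m n Z r i = card (image Inl ` {R \<in> S. card R = i} :: (nat + nat) set set)"
      unfolding d_bar_row_def by simp
    also have "\<dots> = card {R \<in> S. card R = i}"
      by (rule card_image) (auto simp: inj_on_def inj_image_eq_iff)
    finally show "(\<Sum>R\<in>{R \<in> S. card R = i}. wt m (card R)) = real (d_bar_row k m n Z r i) * wt m i"
      by simp
  qed simp
  finally show ?thesis unfolding wt_def by (simp add: sum_distrib_left field_simps)
qed

lemma preflat_extendable:
  assumes "preflat j E" "j \<le> k - 1"
  shows "extendable E"
proof (rule extendableI)
  have E: "E \<subseteq> {..<m}" "card E + card (zcols E) = j" using assms(1) unfolding preflat_def by auto
  let ?L = "Inl ` E \<union> Inr ` zcols E :: (nat + nat) set"
  show "?L \<subseteq> {..<m} <+> {..<n}" using E zcols_sub by auto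
  show "covers ?L Z" unfolding covers_def zcols_def by (auto simp: image_iff)
  have "card ?L \<le> card (Inl ` E :: (nat + nat) set) + card (Inr ` zcols E :: (nat + nat) set)"
    by (rule card_Un_le)
  then show "card ?L \<le> k - 1" using E(2) assms(2) by (simp add: card_image)
qed simp

text \<open>Besides the rows \<open>E\<close>, a cover containing them needs one more line for each
  edge of \<open>A\<close>, hence at least \<open>k\<close> lines.\<close>

lemma not_extendable:
  assumes A: "A \<subseteq> Z" "matching A" "fst ` A \<inter> E = {}" and E: "finite E" "k \<le> card E + card A"
  shows "\<not> extendable (E \<union> R)"
proof
  assume "extendable (E \<union> R)"
  then obtain L where L: "L \<subseteq> {..<m} <+> {..<n}" "covers L Z" "card L = k - 1"
    "Inl ` (E \<union> R) \<subseteq> L" "finite L" by (rule extendableE)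
  define X :: "(nat + nat) set" where "X = Inl ` fst ` A \<union> Inr ` snd ` A"
  have "card A \<le> card (L \<inter> X)" unfolding X_def by (rule matching_le_cover[OF A(1,2) L(2,5)])
  moreover have "card (Inl ` E :: (nat + nat) set) = card E" by (simp add: card_image)
  moreover have "card (Inl ` E :: (nat + nat) set) + card (L \<inter> X) = card (Inl ` E \<union> (L \<inter> X))"
    using E(1) L(5) A(3) unfolding X_def by (subst card_Un_disjoint) auto
  moreover have "\<dots> \<le> card L" using L by (intro card_mono) auto
  ultimately show False using L(3) E(2) k_pos by linarith
qed

text \<open>At rank \<open>k\<close> the rows \<open>E\<close> and a zero matching outside
  \<open>E\<close> force \<open>k\<close> lines, so every summand of \<open>hit\<close> vanishes
  unless \<open>r\<close> is already in \<open>E\<close>.\<close>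

lemma hit_flat:
  assumes "preflat k E"
  shows "hit E = (if r \<in> E then 1 else 0)"
proof -
  obtain A where A: "A \<subseteq> Z" "matching A" "fst ` A \<inter> E = {}" "snd ` A = zcols E"
    and E: "E \<subseteq> {..<m}" "card E + card (zcols E) = k"
    using assms unfolding preflat_def saturable_def by auto
  have "\<not> extendable (E \<union> R)" for R
    using not_extendable[OF A(1-3), of R] E finite_subset matching_card_snd[OF A(2)] A(4) by auto
  then show ?thesis unfolding hit_def by simp
qed

end

section \<open>Optimal assignments\<close>

text \<open>Agrees with \<open>k_assignment\<close> for \<open>D = {..<n}\<close>; the free column
  set \<open>D\<close> makes it possible to drop the columns \<open>zcols E\<close>.\<close>

definition asg :: "nat \<Rightarrow> nat set \<Rightarrow> nat \<Rightarrow> (nat \<times> nat) set \<Rightarrow> bool" where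
  "asg m D e A \<longleftrightarrow> A \<subseteq> {..<m} \<times> D \<and> card A = e \<and> inj_on fst A \<and> inj_on snd A"

definition opt :: "nat \<Rightarrow> nat set \<Rightarrow> (nat \<times> nat \<Rightarrow> real) \<Rightarrow> nat \<Rightarrow> (nat \<times> nat) set \<Rightarrow> bool" where
  "opt m D c e A \<longleftrightarrow> asg m D e A \<and> (\<forall>B. asg m D e B \<longrightarrow> cost c A \<le> cost c B)"

lemma k_assignment_asg: "k_assignment k m n A \<longleftrightarrow> asg m {..<n} k A"
  unfolding k_assignment_def asg_def positions_def by simp

lemma optimal_assignment_opt: "optimal_assignment k m n c A \<longleftrightarrow> opt m {..<n} c k A"
  unfolding optimal_assignment_def opt_def k_assignment_asg by simp

lemma asg_finite: "asg m D e A \<Longrightarrow> finite D \<Longrightarrow> finite A"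
  unfolding asg_def by (meson finite_SigmaI finite_lessThan finite_subset)

lemma asg_matching: "asg m D e A \<Longrightarrow> finite D \<Longrightarrow> matching A"
  using asg_finite unfolding asg_def matching_def by blast

lemma asg_subset: "asg m D e A \<Longrightarrow> B \<subseteq> A \<Longrightarrow> asg m D (card B) B"
  unfolding asg_def by (meson inj_on_subset subset_trans)

lemma asg_exists:
  assumes "e \<le> m" "e \<le> card D" "finite D"
  shows "\<exists>A. asg m D e A"
proof -
  obtain D' where D': "D' \<subseteq> D" "card D' = e"
    using obtain_subset_with_card_n[OF assms(2)] by metis
  have "finite D'" using D' assms(3) finite_subset by blast
  then obtain f where f: "bij_betw f {0..<e} D'" using ex_bij_betw_nat_finite[of D'] D'(2) by auto
  have "asg m D e ((\<lambda>i. (i, f i)) ` {0..<e})"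
    unfolding asg_def
  proof (intro conjI)
    show "(\<lambda>i. (i, f i)) ` {0..<e} \<subseteq> {..<m} \<times> D"
      using assms(1) D'(1) bij_betwE[OF f] by fastforce
    show "card ((\<lambda>i. (i, f i)) ` {0..<e}) = e" by (subst card_image) (auto simp: inj_on_def)
    show "inj_on snd ((\<lambda>i. (i, f i)) ` {0..<e})"
      using bij_betw_imp_inj_on[OF f] by (auto simp: inj_on_def)
  qed (auto simp: inj_on_def)
  then show ?thesis by blast
qed

lemma finite_asg: "finite D \<Longrightarrow> finite {A. asg m D e A}"
  by (rule finite_subset[of _ "Pow ({..<m} \<times> D)"]) (auto simp: asg_def)

lemma opt_exists:
  assumes "e \<le> m" "e \<le> card D" "finite D"
  shows "\<exists>A. opt m D c e A"
proof -
  define S where "S = {A. asg m D e A}"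
  have "finite S" "S \<noteq> {}" using asg_exists[OF assms] finite_asg[OF assms(3)] unfolding S_def by auto
  note min = arg_min_if_finite[OF this, of "cost c"]
  have "opt m D c e (arg_min_on (cost c) S)"
    unfolding opt_def
  proof (intro conjI allI impI)
    show "asg m D e (arg_min_on (cost c) S)" using min(1) unfolding S_def by simp
    fix B assume "asg m D e B"
    then have "B \<in> S" unfolding S_def by simp
    then show "cost c (arg_min_on (cost c) S) \<le> cost c B" using min(2) not_less by blast
  qed
  then show ?thesis by blast
qed

text \<open>\<open>matching_augment\<close> redistributes the edges of an optimal
  \<open>e\<close>-assignment and an optimal \<open>Suc e\<close>-assignment at equal total cost.
  The smaller part is no cheaper than \<open>A\<close>, so the larger part is optimal, and it keeps
  the rows of \<open>A\<close>.\<close>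

lemma opt_augment:
  assumes D: "finite D" and A: "opt m D c e A" and e: "e < m" "e < card D"
  shows "\<exists>A'. opt m D c (Suc e) A' \<and> fst ` A \<subseteq> fst ` A'"
proof -
  obtain N where N: "opt m D c (Suc e) N" using opt_exists[of "Suc e" m D c] D e by auto
  have aA: "asg m D e A" and aN: "asg m D (Suc e) N" using A N unfolding opt_def by auto
  have fin: "finite A" "finite N" using aA aN D asg_finite by auto
  have cards: "card A = e" "card N = Suc e" using aA aN unfolding asg_def by auto
  then obtain M' N' where MN: "matching M'" "matching N'" "M' \<union> N' = A \<union> N" "M' \<inter> N' = A \<inter> N"
    "card M' = Suc e" "fst ` A \<subseteq> fst ` M'"
    using matching_augment[OF asg_matching[OF aA D] asg_matching[OF aN D]] by auto
  have fin': "finite M'" "finite N'" using MN unfolding matching_def by auto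
  have "card M' + card N' = card A + card N"
    using card_Un_Int[OF fin'] card_Un_Int[OF fin] MN by simp
  then have cN': "card N' = e" using MN cards by simp
  have sub: "M' \<subseteq> {..<m} \<times> D" "N' \<subseteq> {..<m} \<times> D" using MN(3) aA aN unfolding asg_def by blast+
  have aM': "asg m D (Suc e) M'" and aN': "asg m D e N'"
    using MN sub cN' unfolding asg_def matching_def by auto
  have "cost c M' + cost c N' = cost c A + cost c N"
    unfolding cost_def using sum.union_inter[OF fin', of c] sum.union_inter[OF fin, of c] MN by simp
  moreover have "cost c A \<le> cost c N'" using A aN' unfolding opt_def by blast
  ultimately have "cost c M' \<le> cost c N" by simp
  then have "opt m D c (Suc e) M'" using N aM' unfolding opt_def by force
  then show ?thesis using MN(6) by blast
qed

text \<open>At least \<open>e\<close> entries of \<open>B\<close> lie in columns from \<open>D\<close>.\<close>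
lemma opt_lower_bound:
  assumes A: "opt m D c e A" and B: "asg m D' e' B" and D: "D \<subseteq> D'" "finite D'"
    and e: "e + card (D' - D) \<le> e'"
    and nonneg: "\<And>p. p \<in> {..<m} \<times> D' \<Longrightarrow> 0 \<le> c p"
  shows "cost c A \<le> cost c B"
proof -
  define B1 where "B1 = {p\<in>B. snd p \<in> D}"
  define B2 where "B2 = {p\<in>B. snd p \<notin> D}"
  have fB: "finite B" using B D(2) by (rule asg_finite)
  have fin: "finite B1" "finite B2" using fB unfolding B1_def B2_def by auto
  have "B = B1 \<union> B2" "B1 \<inter> B2 = {}" unfolding B1_def B2_def by auto
  then have "card B = card B1 + card B2" using fin by (simp add: card_Un_disjoint)
  moreover have "card B2 \<le> card (D' - D)"
  proof (rule card_inj_on_le)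
    show "inj_on snd B2" using B unfolding asg_def B2_def by (auto intro: inj_on_subset)
    show "snd ` B2 \<subseteq> D' - D" using B unfolding asg_def B2_def by auto
  qed (use D in auto)
  ultimately have "e \<le> card B1" using B e unfolding asg_def by simp
  then obtain C where C: "C \<subseteq> B1" "card C = e"
    using obtain_subset_with_card_n by metis
  then have CB: "C \<subseteq> B" unfolding B1_def by auto
  have "asg m D e C"
    using asg_subset[OF B CB] C unfolding asg_def B1_def by auto
  then have "cost c A \<le> cost c C" using A unfolding opt_def by blast
  also have "\<dots> \<le> cost c B" unfolding cost_def
    using B CB fB nonneg unfolding asg_def by (intro sum_mono2) auto
  finally show ?thesis .
qed

text \<open>The row involution acts on assignments as a bijection that turns the cost under
  \<open>c'\<close> into the cost under \<open>c\<close>.\<close>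

lemma opt_permute:
  assumes A: "opt m D c' e A" and \<tau>: "\<And>x. \<tau> (\<tau> x) = x" "\<And>x. x < m \<Longrightarrow> \<tau> x < m"
    and c': "\<And>x d. x < m \<Longrightarrow> d \<in> D \<Longrightarrow> c' (x, d) = c (\<tau> x, d)"
  shows "opt m D c e (map_prod \<tau> id ` A)"
proof -
  let ?t = "map_prod \<tau> id :: nat \<times> nat \<Rightarrow> nat \<times> nat"
  have inj\<tau>: "inj \<tau>" using \<tau>(1) by (metis injI)
  have injt: "inj_on ?t S" for S using inj\<tau> by (auto simp: inj_on_def dest: injD)
  have asgt: "asg m D e (?t ` B)" if "asg m D e B" for B
    unfolding asg_def
  proof (intro conjI)
    show "?t ` B \<subseteq> {..<m} \<times> D" using that \<tau>(2) unfolding asg_def by auto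
    show "card (?t ` B) = e" using that card_image[OF injt] unfolding asg_def by metis
    have "inj_on (\<tau> \<circ> fst) B"
      using that inj\<tau> unfolding asg_def by (meson comp_inj_on inj_on_subset subset_UNIV)
    moreover have "fst \<circ> ?t = \<tau> \<circ> fst" "snd \<circ> ?t = snd" by auto
    ultimately show "inj_on fst (?t ` B)" "inj_on snd (?t ` B)"
      using that unfolding asg_def by (simp_all add: inj_on_imageI)
  qed
  have costt: "cost c (?t ` B) = cost c' B" if "asg m D e B" for B
  proof -
    have "cost c (?t ` B) = (\<Sum>p\<in>B. c (?t p))" unfolding cost_def by (simp add: sum.reindex[OF injt])
    also have "\<dots> = cost c' B" unfolding cost_def
      using that c' unfolding asg_def by (intro sum.cong) auto
    finally show ?thesis .
  qed
  have "?t \<circ> ?t = id" using \<tau>(1) by auto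
  then have tt: "?t ` ?t ` B = B" for B by (simp add: image_comp)
  show ?thesis unfolding opt_def
  proof (intro conjI allI impI)
    show "asg m D e (?t ` A)" using A asgt unfolding opt_def by blast
    fix B assume B: "asg m D e B"
    have "cost c (?t ` A) = cost c' A" using A costt unfolding opt_def by blast
    also have "\<dots> \<le> cost c' (?t ` B)" using A asgt[OF B] unfolding opt_def by blast
    also have "\<dots> = cost c B" using costt[OF asgt[OF B]] tt by simp
    finally show "cost c (?t ` A) \<le> cost c B" .
  qed
qed

section \<open>Generic costs and good row sets\<close>

definition ess :: "nat \<Rightarrow> nat \<Rightarrow> nat \<Rightarrow> (nat \<times> nat \<Rightarrow> real) \<Rightarrow> nat set" where
  "ess j m n c = {a. a < m \<and> (\<forall>A. optimal_assignment j m n c A \<longrightarrow> uses_row a A)}"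

context zero_pattern
begin

definition cols :: "nat set \<Rightarrow> nat set" where
  "cols E = {..<n} - zcols E"

text \<open>For a flat \<open>E\<close> and generic costs this forces \<open>ess j m n c = E\<close>
  (see \<open>good_ess\<close>), yet it reads only the columns \<open>cols E\<close>, where rows
  outside \<open>E\<close> have no zeros.\<close>

definition good :: "(nat \<times> nat \<Rightarrow> real) \<Rightarrow> nat set \<Rightarrow> bool" where
  "good c E \<longleftrightarrow> (\<exists>A. opt m (cols E) c (card E) A \<and> fst ` A = E)"

text \<open>Deterministic properties of almost every cost matrix. Distinct sets of positions off
  \<open>Z\<close> have distinct costs, so optimal assignments can differ only in zeros.\<close>

definition generic :: "(nat \<times> nat \<Rightarrow> real) \<Rightarrow> bool" where
  "generic c \<longleftrightarrow> (\<forall>p\<in>Z. c p = 0) \<and> (\<forall>p\<in>positions m n - Z. 0 < c p) \<and>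
     (\<forall>A B. A \<subseteq> positions m n - Z \<longrightarrow> B \<subseteq> positions m n - Z \<longrightarrow> cost c A = cost c B \<longrightarrow> A = B)"

lemma finite_cols: "finite (cols E)"
  unfolding cols_def by simp

lemma generic_nonneg: "generic c \<Longrightarrow> p \<in> {..<m} \<times> {..<n} \<Longrightarrow> 0 \<le> c p"
  unfolding generic_def positions_def by (cases "p \<in> Z") (auto intro: less_imp_le)

lemma cost_zeros: "generic c \<Longrightarrow> B \<subseteq> Z \<Longrightarrow> cost c B = 0"
  unfolding generic_def cost_def by (intro sum.neutral) auto

lemma cost_nonzero_part:
  assumes "generic c" "finite A"
  shows "cost c A = cost c (A - Z)"
  unfolding cost_def using assms unfolding generic_def
  by (intro sum.mono_neutral_right) auto

lemma generic_unique:
  assumes "generic c" "asg m D e A" "asg m D e B" "D \<subseteq> {..<n}" "cost c A = cost c B"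
  shows "A - Z = B - Z"
proof -
  have D: "finite D" using assms(4) finite_subset by blast
  have "A - Z \<subseteq> positions m n - Z" "B - Z \<subseteq> positions m n - Z"
    using assms(2-4) unfolding asg_def positions_def by auto
  moreover have "cost c (A - Z) = cost c (B - Z)"
    using assms cost_nonzero_part asg_finite[OF _ D] by metis
  ultimately show ?thesis using assms(1) unfolding generic_def by blast
qed

lemma cols_nonzero: "b \<in> cols E \<Longrightarrow> a \<notin> E \<Longrightarrow> (a, b) \<notin> Z"
  unfolding cols_def zcols_def by auto

text \<open>A zero matching onto \<open>zcols E\<close> that avoids \<open>E'\<close> leaves a zero
  outside \<open>E'\<close> in each of these columns.\<close>

lemma saturable_zcols:
  assumes "saturable E' (zcols E)" "E \<subseteq> E'"
  shows "zcols E' = zcols E"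
proof
  show "zcols E' \<subseteq> zcols E" using assms(2) by (rule zcols_mono)
  show "zcols E \<subseteq> zcols E'"
  proof
    fix b assume b: "b \<in> zcols E"
    obtain A where A: "A \<subseteq> Z" "fst ` A \<inter> E' = {}" "snd ` A = zcols E"
      using assms(1) unfolding saturable_def by blast
    then obtain a where "(a, b) \<in> A" using b by force
    then show "b \<in> zcols E'" using A unfolding zcols_def by force
  qed
qed

lemma flat_zcols_insert: "flat j E \<Longrightarrow> a \<in> {..<m} - E \<Longrightarrow> zcols (insert a E) = zcols E"
  unfolding flat_def by (intro saturable_zcols) auto

lemma flat_cols_insert: "flat j E \<Longrightarrow> a \<in> {..<m} - E \<Longrightarrow> cols (insert a E) = cols E"
  unfolding cols_def by (simp add: flat_zcols_insert)

lemma preflatD: "preflat j E \<Longrightarrow> E \<subseteq> {..<m} \<and> finite E \<and> card E + card (zcols E) = j"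
  unfolding preflat_def using finite_subset by blast

lemma flat_preflat_insert:
  assumes "flat j E" "a \<in> {..<m} - E"
  shows "preflat (Suc j) (insert a E)"
proof -
  have E: "E \<subseteq> {..<m}" "finite E" "card E + card (zcols E) = j" "saturable (insert a E) (zcols E)"
    using assms preflatD[of j E] unfolding flat_def by auto
  then show ?thesis
    unfolding preflat_def flat_zcols_insert[OF assms] using assms(2) by simp
qed

text \<open>Appending the zero matching \<open>B\<close> costs nothing, and as many columns as rows
  are added, so \<open>opt_lower_bound\<close> shows that no assignment in the larger column set is
  cheaper.\<close>

lemma good_closure:
  assumes gen: "generic c" and good: "good c E" and E: "E \<subseteq> E'" "E' \<subseteq> {..<m}"
    and B: "B \<subseteq> Z" "matching B" "fst ` B = E' - E" "snd ` B = zcols E - zcols E'"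
  shows "good c E'"
proof -
  obtain A where A: "opt m (cols E) c (card E) A" "fst ` A = E" using good unfolding good_def by auto
  have aA: "asg m (cols E) (card E) A" using A unfolding opt_def by auto
  have fE: "finite E'" using E(2) by (rule finite_subset) simp
  have fE0: "finite E" using E(1) fE by (rule finite_subset)
  have fA: "finite A" using aA finite_cols by (rule asg_finite)
  have fB: "finite B" using B(2) unfolding matching_def by auto
  have sA: "snd ` A \<subseteq> cols E" using aA unfolding asg_def by auto
  have sub: "cols E \<subseteq> cols E'" using zcols_mono[OF E(1)] unfolding cols_def by auto
  have diff: "cols E' - cols E = zcols E - zcols E'" using zcols_sub unfolding cols_def by auto
  have m: "matching (A \<union> B)"
    by (rule matching_Un) (use asg_matching[OF aA finite_cols] B A sA cols_def in auto)
  have f: "fst ` (A \<union> B) = E'" using A B E by (auto simp: image_Un)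
  then have cAB: "card (A \<union> B) = card E'" using matching_card_fst[OF m] by simp
  have s: "snd ` (A \<union> B) \<subseteq> cols E'" using sA sub B(4) zcols_sub[of E]
    unfolding cols_def by (auto simp: image_Un)
  have aAB: "asg m (cols E') (card E') (A \<union> B)"
    unfolding asg_def
  proof (intro conjI)
    show "A \<union> B \<subseteq> {..<m} \<times> cols E'"
    proof
      fix p assume "p \<in> A \<union> B"
      then have "fst p \<in> E'" "snd p \<in> cols E'" using f s by blast+
      then show "p \<in> {..<m} \<times> cols E'" using E(2) by (cases p) auto
    qed
  qed (use m cAB in \<open>auto simp: matching_def\<close>)
  have "A \<inter> B = {}" using A(2) B(3) by force
  then have "cost c (A \<union> B) = cost c A + cost c B"
    unfolding cost_def using fA fB by (intro sum.union_disjoint)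
  then have cost: "cost c (A \<union> B) = cost c A" using cost_zeros[OF gen B(1)] by simp
  have "card (E' - E) = card (zcols E - zcols E')"
    using matching_card_fst[OF B(2)] matching_card_snd[OF B(2)] B(3,4) by simp
  then have "card E + card (cols E' - cols E) \<le> card E'"
    unfolding diff using card_Diff_subset[OF fE0 E(1)] card_mono[OF fE E(1)] by simp
  then have "cost c A \<le> cost c C" if "asg m (cols E') (card E') C" for C
    using opt_lower_bound[OF A(1) that sub finite_cols] generic_nonneg[OF gen]
    unfolding cols_def by auto
  then show ?thesis unfolding good_def opt_def using aAB cost f by auto
qed

text \<open>The columns \<open>zcols E\<close> absorb at most \<open>card (zcols E)\<close> entries
  of any \<open>j\<close>-assignment, so the cost of \<open>A\<close> is a lower bound; it is
  attained by filling these columns with zeros.\<close>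

lemma good_optimal:
  assumes gen: "generic c" and A: "opt m (cols E) c (card E) A" "fst ` A = E"
    and j: "card E + card (zcols E) = j"
    and B: "B \<subseteq> Z" "matching B" "fst ` B \<inter> E = {}" "snd ` B = zcols E"
  shows "optimal_assignment j m n c (A \<union> B)"
proof -
  have aA: "asg m (cols E) (card E) A" using A unfolding opt_def by auto
  have fA: "finite A" using aA finite_cols by (rule asg_finite)
  have fB: "finite B" using B(2) unfolding matching_def by auto
  have sA: "snd ` A \<subseteq> cols E" using aA unfolding asg_def by auto
  have m: "matching (A \<union> B)"
    by (rule matching_Un) (use asg_matching[OF aA finite_cols] B A sA cols_def in auto)
  have disj: "A \<inter> B = {}" using A(2) B(3) by force
  have "card (A \<union> B) = card A + card B" using disj fA fB by (simp add: card_Un_disjoint)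
  then have cAB: "card (A \<union> B) = j"
    using j matching_card_snd[OF B(2)] B(4) aA unfolding asg_def by simp
  have "A \<union> B \<subseteq> {..<m} \<times> {..<n}" using aA B(1) Z_D unfolding asg_def cols_def by auto
  then have aAB: "asg m {..<n} j (A \<union> B)" using m cAB unfolding asg_def matching_def by auto
  have "cost c (A \<union> B) = cost c A + cost c B"
    unfolding cost_def using fA fB disj by (intro sum.union_disjoint)
  then have cost: "cost c (A \<union> B) = cost c A" using cost_zeros[OF gen B(1)] by simp
  have "{..<n} - cols E = zcols E" using zcols_sub unfolding cols_def by auto
  then have "card E + card ({..<n} - cols E) \<le> j" using j by simp
  moreover have "cols E \<subseteq> {..<n}" unfolding cols_def by auto
  ultimately have "cost c A \<le> cost c C" if "asg m {..<n} j C" for C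
    using opt_lower_bound[OF A(1) that] generic_nonneg[OF gen] by auto
  then show ?thesis unfolding optimal_assignment_opt opt_def using aAB cost by auto
qed

text \<open>By flatness a row outside \<open>E\<close> is avoided by some zero matching, hence by
  some optimum. Conversely, an optimum takes all its entries off \<open>Z\<close> from
  \<open>A\<close>, so its entries outside the rows \<open>E\<close> lie in \<open>zcols E\<close>;
  if it missed a row of \<open>E\<close>, it would have fewer than \<open>j\<close> entries.\<close>

lemma good_ess:
  assumes gen: "generic c" and flat: "flat j E" and good: "good c E"
  shows "ess j m n c = E"
proof -
  obtain A where A: "opt m (cols E) c (card E) A" "fst ` A = E" using good unfolding good_def by auto
  have E: "E \<subseteq> {..<m}" "finite E" "card E + card (zcols E) = j"
    using flat preflatD unfolding flat_def by auto
  show ?thesis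
  proof (intro equalityI subsetI)
    fix a assume a: "a \<in> ess j m n c"
    show "a \<in> E"
    proof (rule ccontr)
      assume "a \<notin> E"
      then have "saturable (insert a E) (zcols E)" using a flat unfolding ess_def flat_def by auto
      then obtain B where B: "B \<subseteq> Z" "matching B" "fst ` B \<inter> insert a E = {}" "snd ` B = zcols E"
        unfolding saturable_def by auto
      have "optimal_assignment j m n c (A \<union> B)"
        using B by (intro good_optimal[OF gen A E(3)]) auto
      then have "uses_row a (A \<union> B)" using a unfolding ess_def by blast
      then have "a \<in> fst ` A \<or> a \<in> fst ` B" unfolding uses_row_def by force
      then show False using A(2) B(3) \<open>a \<notin> E\<close> by auto
    qed
  next
    fix a assume a: "a \<in> E"
    obtain B where B: "B \<subseteq> Z" "matching B" "fst ` B \<inter> E = {}" "snd ` B = zcols E"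
      using flat unfolding flat_def preflat_def saturable_def by auto
    have AB: "opt m {..<n} c j (A \<union> B)"
      using good_optimal[OF gen A E(3) B] unfolding optimal_assignment_opt .
    have "uses_row a C" if "opt m {..<n} c j C" for C
    proof (rule ccontr)
      assume nu: "\<not> uses_row a C"
      have aC: "asg m {..<n} j C" and aAB: "asg m {..<n} j (A \<union> B)" using that AB unfolding opt_def by auto
      have "cost c C = cost c (A \<union> B)" using that AB unfolding opt_def by (simp add: order_antisym)
      then have "C - Z = A \<union> B - Z" using generic_unique[OF gen aC aAB] by simp
      then have CZ: "C - Z \<subseteq> A" using B(1) by auto
      define C1 where "C1 = {p\<in>C. fst p \<in> E}"
      define C2 where "C2 = {p\<in>C. fst p \<notin> E}"
      have fC: "finite C" using aC by (rule asg_finite) simp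
      have "C = C1 \<union> C2" "C1 \<inter> C2 = {}" unfolding C1_def C2_def by auto
      then have "card C = card C1 + card C2" using fC by (metis card_Un_disjoint finite_Un)
      moreover have "card C1 \<le> card (E - {a})"
      proof (rule card_inj_on_le)
        show "inj_on fst C1" using aC unfolding asg_def C1_def by (auto intro: inj_on_subset)
        show "fst ` C1 \<subseteq> E - {a}" using nu unfolding C1_def uses_row_def by force
      qed (use E in auto)
      moreover have "card C2 \<le> card (zcols E)"
      proof (rule card_inj_on_le)
        show "inj_on snd C2" using aC unfolding asg_def C2_def by (auto intro: inj_on_subset)
        show "snd ` C2 \<subseteq> zcols E"
        proof
          fix b assume "b \<in> snd ` C2"
          then obtain x where x: "(x, b) \<in> C" "x \<notin> E" unfolding C2_def by auto
          then have "(x, b) \<notin> A" using A(2) by force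
          then have "(x, b) \<in> Z" using x CZ by auto
          then show "b \<in> zcols E" using x unfolding zcols_def by auto
        qed
      qed (rule finite_zcols)
      moreover have "card (E - {a}) < card E" using a E(2) by (intro psubset_card_mono) auto
      ultimately show False using aC E(3) unfolding asg_def by simp
    qed
    then show "a \<in> ess j m n c" unfolding ess_def optimal_assignment_opt using a E(1) by auto
  qed
qed

text \<open>Existence comes from \<open>opt_augment\<close>. For uniqueness, the entry of a new row
  lies in \<open>cols E\<close> and hence off \<open>Z\<close>, where generic costs determine the
  optimum.\<close>

lemma good_next:
  assumes gen: "generic c" and flat: "flat j E" and good: "good c E" and j: "j < m" "j < n"
  shows "\<exists>!a. a \<in> {..<m} - E \<and> good c (insert a E)"
proof (rule ex_ex1I)
  obtain A where A: "opt m (cols E) c (card E) A" "fst ` A = E" using good unfolding good_def by auto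
  have E: "E \<subseteq> {..<m}" "finite E" "card E + card (zcols E) = j"
    using flat preflatD unfolding flat_def by auto
  have "card (cols E) = n - card (zcols E)" unfolding cols_def
    using zcols_sub finite_zcols by (simp add: card_Diff_subset)
  then have "card E < card (cols E)" "card E < m" using E(3) j by auto
  then obtain A' where A': "opt m (cols E) c (Suc (card E)) A'" "E \<subseteq> fst ` A'"
    using opt_augment[OF finite_cols A(1)] A(2) by auto
  have aA': "asg m (cols E) (Suc (card E)) A'" using A' unfolding opt_def by auto
  have "card (fst ` A') = Suc (card E)" "fst ` A' \<subseteq> {..<m}"
    using aA' unfolding asg_def by (auto simp: card_image)
  then have "card (fst ` A' - E) = 1" using A'(2) E(2) by (simp add: card_Diff_subset)
  then obtain a where a: "fst ` A' - E = {a}" by (auto simp: card_1_singleton_iff)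
  then have "a \<in> {..<m} - E" "fst ` A' = insert a E"
    using A'(2) \<open>fst ` A' \<subseteq> {..<m}\<close> by auto
  moreover from this have "good c (insert a E)"
    unfolding good_def flat_cols_insert[OF flat \<open>a \<in> {..<m} - E\<close>] using A'(1) E(2) by auto
  ultimately show "\<exists>a. a \<in> {..<m} - E \<and> good c (insert a E)" by blast
next
  fix a b
  assume a: "a \<in> {..<m} - E \<and> good c (insert a E)" and b: "b \<in> {..<m} - E \<and> good c (insert b E)"
  have fE: "finite E" using flat preflatD unfolding flat_def by auto
  obtain A where A: "opt m (cols E) c (Suc (card E)) A" "fst ` A = insert a E"
    using a flat_cols_insert[OF flat, of a] fE unfolding good_def by auto
  obtain B where B: "opt m (cols E) c (Suc (card E)) B" "fst ` B = insert b E"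
    using b flat_cols_insert[OF flat, of b] fE unfolding good_def by auto
  have aA: "asg m (cols E) (Suc (card E)) A" and aB: "asg m (cols E) (Suc (card E)) B"
    using A B unfolding opt_def by auto
  have "cost c A = cost c B" using A B unfolding opt_def by (simp add: order_antisym)
  then have AB: "A - Z = B - Z"
    using generic_unique[OF gen aA aB] unfolding cols_def by auto
  obtain d where d: "(a, d) \<in> A" using A(2) by force
  then have "d \<in> cols E" using aA unfolding asg_def by auto
  then have "(a, d) \<notin> Z" using a cols_nonzero by auto
  then have "(a, d) \<in> B" using d AB by blast
  then have "a \<in> insert b E" using B(2) by force
  then show "a = b" using a by auto
qed

lemma good_permute:
  assumes good: "good c' E" and \<tau>: "\<And>x. \<tau> (\<tau> x) = x" "\<And>x. x < m \<Longrightarrow> \<tau> x < m"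
    and c': "\<And>x d. x < m \<Longrightarrow> d \<in> cols E \<Longrightarrow> c' (x, d) = c (\<tau> x, d)"
    and cols: "cols (\<tau> ` E) = cols E"
  shows "good c (\<tau> ` E)"
proof -
  obtain A where A: "opt m (cols E) c' (card E) A" "fst ` A = E" using good unfolding good_def by auto
  have "opt m (cols E) c (card E) (map_prod \<tau> id ` A)" using A(1) \<tau> c' by (rule opt_permute)
  moreover have "fst ` map_prod \<tau> id ` A = \<tau> ` E" using A(2) by (force simp: image_image)
  moreover have "card (\<tau> ` E) = card E" using \<tau>(1) by (intro card_image inj_onI) metis
  ultimately show ?thesis unfolding good_def using cols by auto
qed

end

section \<open>Exchangeability of the rows outside a flat\<close>

context zero_pattern
begin

lemma sets_good:
  assumes Y: "\<And>p. p \<in> positions m n \<Longrightarrow> Y p \<in> borel_measurable N"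
  shows "{\<omega> \<in> space N. good (\<lambda>p. Y p \<omega>) E} \<in> sets N"
proof -
  have fin: "finite {A. asg m (cols E) (card E) A}" by (rule finite_asg[OF finite_cols])
  have sub: "A \<subseteq> positions m n" if "asg m (cols E) (card E) A" for A
    using that unfolding asg_def cols_def positions_def by auto
  have "{\<omega> \<in> space N. good (\<lambda>p. Y p \<omega>) E} = {\<omega> \<in> space N. \<exists>A\<in>{A. asg m (cols E) (card E) A \<and> fst ` A = E}.
      \<forall>B\<in>{A. asg m (cols E) (card E) A}. cost (\<lambda>p. Y p \<omega>) A \<le> cost (\<lambda>p. Y p \<omega>) B}"
    unfolding good_def opt_def by auto
  also have "\<dots> \<in> sets N"
  proof (intro sets.sets_Collect_finite_Ex sets.sets_Collect_finite_All')
    fix A B assume "A \<in> {A. asg m (cols E) (card E) A \<and> fst ` A = E}" "B \<in> {A. asg m (cols E) (card E) A}"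
    then have "A \<subseteq> positions m n" "B \<subseteq> positions m n" using sub by auto
    then show "{\<omega> \<in> space N. cost (\<lambda>p. Y p \<omega>) A \<le> cost (\<lambda>p. Y p \<omega>) B} \<in> sets N"
      unfolding cost_def by (intro borel_measurable_le borel_measurable_sum Y) auto
  next
    show "finite {A. asg m (cols E) (card E) A \<and> fst ` A = E}" by (rule finite_subset[OF _ fin]) auto
    show "{A. asg m (cols E) (card E) A} \<noteq> {}" if "A \<in> {A. asg m (cols E) (card E) A \<and> fst ` A = E}" for A
      using that by auto
  qed (rule fin)
  finally show ?thesis .
qed

lemma good_cong:
  assumes "\<And>p. p \<in> positions m n \<Longrightarrow> c p = c' p"
  shows "good c E \<longleftrightarrow> good c' E"
proof -
  have "cost c A = cost c' A" if "asg m (cols E) (card E) A" for A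
    unfolding cost_def using that assms unfolding asg_def cols_def positions_def
    by (intro sum.cong) auto
  then have "opt m (cols E) c (card E) A \<longleftrightarrow> opt m (cols E) c' (card E) A" for A
    unfolding opt_def by auto
  then show ?thesis unfolding good_def by simp
qed

end

section \<open>One growth step and the starting flat\<close>

context rap_pattern
begin

text \<open>The closure of \<open>insert a E\<close> is the next flat; goodness and
  \<open>hit\<close> both survive the closure.\<close>

lemma hit_next:
  assumes gen: "generic c" and flat: "flat j E" and a: "a \<in> {..<m} - E" and good: "good c (insert a E)"
  shows "\<exists>E'. flat (Suc j) E' \<and> good c E' \<and> hit E' = hit (insert a E)"
proof -
  obtain E' A where E': "insert a E \<subseteq> E'" "flat (Suc j) E'" "A \<subseteq> Z" "matching A"
    "fst ` A = E' - insert a E" "snd ` A = zcols (insert a E) - zcols E'"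
    using flat_closure[OF flat_preflat_insert[OF flat a]] by blast
  have m: "E' \<subseteq> {..<m}" using E'(2) unfolding flat_def preflat_def by blast
  have "good c E'" by (rule good_closure[OF gen good E'(1) m E'(3-6)])
  moreover have "hit E' = hit (insert a E)"
  proof (rule hit_closure[OF E'(1) m E'(3-5)])
    fix x b assume "(x, b) \<in> Z" "b \<in> snd ` A"
    then show "x \<in> E'" unfolding E'(6) zcols_def by blast
  qed
  ultimately show ?thesis using E'(2) by blast
qed

text \<open>The growth starts at the largest number \<open>j\<close> of independent zeros. Koenig's
  theorem matches its rows by zeros within \<open>cols E\<close>, which is optimal for all generic
  costs; the same matching shows that passing from \<open>{}\<close> to these rows leaves
  \<open>hit\<close> unchanged. The returned matching of size \<open>j\<close> serves the case
  \<open>k \<le> j\<close>.\<close>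

lemma start_flat:
  obtains j E A where "flat j E" "\<forall>c. generic c \<longrightarrow> good c E" "hit E = hit {}"
    "A \<subseteq> Z" "matching A" "card A = j"
proof -
  obtain E A B where EA: "E \<subseteq> {..<m}" "A \<subseteq> Z" "matching A" "fst ` A = E" "snd ` A \<inter> zcols E = {}"
    and B: "B \<subseteq> Z" "matching B" "fst ` B \<inter> E = {}" "snd ` B = zcols E"
    and pre: "preflat (card E + card (zcols E)) E" by (rule koenig)
  obtain E' C where E': "E \<subseteq> E'" "flat (card E + card (zcols E)) E'" "C \<subseteq> Z" "matching C"
    "fst ` C = E' - E" "snd ` C = zcols E - zcols E'"
    using flat_closure[OF pre] by blast
  have m: "E' \<subseteq> {..<m}" using E'(2) unfolding flat_def preflat_def by blast
  have mAB: "matching (A \<union> B)" by (rule matching_Un) (use EA B in auto)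
  have AB: "A \<inter> B = {}" using EA(4) B(3) by force
  have "card (A \<union> B) = card A + card B"
    using AB EA(3) B(2) unfolding matching_def by (simp add: card_Un_disjoint)
  then have cAB: "card (A \<union> B) = card E + card (zcols E)"
    using matching_card_fst[OF EA(3)] matching_card_snd[OF B(2)] EA(4) B(4) by simp
  have "good c E'" if gen: "generic c" for c
  proof (rule good_closure[OF gen _ E'(1) m E'(3-6)])
    have sA: "A \<subseteq> {..<m} \<times> cols E"
    proof
      fix p assume p: "p \<in> A"
      then have "snd p \<notin> zcols E" using EA(5) by blast
      then show "p \<in> {..<m} \<times> cols E" using p EA(2) Z_D unfolding cols_def by (cases p) auto
    qed
    have aA: "asg m (cols E) (card E) A"
      using sA EA(3,4) matching_card_fst[OF EA(3)] unfolding asg_def matching_def by simp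
    have "0 \<le> cost c D" if "asg m (cols E) (card E) D" for D
      unfolding cost_def using that generic_nonneg[OF gen] unfolding asg_def cols_def
      by (intro sum_nonneg) auto
    then have "opt m (cols E) c (card E) A"
      unfolding opt_def using aA cost_zeros[OF gen EA(2)] by simp
    then show "good c E" unfolding good_def using EA(4) by blast
  qed
  moreover have "hit E' = hit {}"
  proof -
    have "hit E' = hit E"
    proof (rule hit_closure[OF E'(1) m E'(3-5)])
      fix x b assume "(x, b) \<in> Z" "b \<in> snd ` C"
      then show "x \<in> E'" unfolding E'(6) zcols_def by blast
    qed
    also have "hit E = hit {}"
    proof (rule hit_closure[OF _ EA(1-3)])
      fix x b assume "(x, b) \<in> Z" "b \<in> snd ` A"
      then show "x \<in> E" using EA(5) unfolding zcols_def by blast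
    qed (use EA(4) in simp_all)
    finally show ?thesis .
  qed
  moreover have "A \<union> B \<subseteq> Z" using EA(2) B(1) by blast
  ultimately show ?thesis using that E'(2) mAB cAB by blast
qed

end

section \<open>Almost sure genericity of the random costs\<close>

locale free_row_RAP = standard_RAP +
  fixes r :: nat
  assumes row: "r < m" and free: "\<And>j. (r, j) \<notin> Z"

sublocale free_row_RAP \<subseteq> rap_pattern m n Z k r
  by unfold_locales (use Z_subset k_pos k_le row free in auto)

context free_row_RAP
begin

abbreviation I where "I \<equiv> positions m n - Z"

lemma finite_I: "finite I"
  unfolding positions_def by simp

lemma r_in_I: "(r, 0) \<in> I"
  using row free k_pos k_n unfolding positions_def by auto

lemma X_measurable [measurable]: "p \<in> I \<Longrightarrow> X p \<in> borel_measurable M"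
  using distributed_measurable[OF X_exponential] by simp

lemma X_measurable_positions:
  assumes "p \<in> positions m n"
  shows "X p \<in> borel_measurable M"
proof (cases "p \<in> Z")
  case True
  then show ?thesis using X_zero by (subst measurable_cong[of _ _ "\<lambda>_. 0"]) auto
next
  case False
  then show ?thesis using assms X_measurable by simp
qed

lemma cost_measurable:
  "A \<subseteq> positions m n \<Longrightarrow> (\<lambda>\<omega>. cost (\<lambda>p. X p \<omega>) A) \<in> borel_measurable M"
  unfolding cost_def by (intro borel_measurable_sum X_measurable_positions) auto

lemma AE_X_pos:
  assumes "p \<in> I"
  shows "AE \<omega> in M. 0 < X p \<omega>"
proof -
  have "prob {\<omega> \<in> space M. X p \<omega> \<le> 0} = 0"
    using exponential_distributedD_le[OF X_exponential[OF assms], of 0] by simp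
  then have "AE \<omega> in M. \<not> X p \<omega> \<le> 0"
    using assms by (subst prob_Collect_eq_0[symmetric]) auto
  then show ?thesis by (rule AE_mp) simp
qed

lemma AE_X_neq:
  assumes "p \<in> I"
  shows "AE \<omega> in M. X p \<omega> \<noteq> c"
proof -
  have "AE x in density lborel (exponential_density 1). x \<noteq> c"
    by (subst AE_density) (auto intro: AE_mp[OF AE_lborel_singleton[of c]])
  then have "AE x in distr M lborel (X p). x \<noteq> c"
    unfolding distributed_distr_eq_density[OF X_exponential[OF assms]] .
  then show ?thesis using assms by (subst (asm) AE_distr_iff) auto
qed

text \<open>The difference of the costs involves some \<open>X p\<close> with coefficient \<open>1\<close> or \<open>-1\<close>,
  and \<open>X p\<close> has no atoms and is independent of the other terms.\<close>
lemma AE_cost_neq: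
  assumes AB: "A \<subseteq> I" "B \<subseteq> I" "A \<noteq> B"
  shows "AE \<omega> in M. cost (\<lambda>p. X p \<omega>) A \<noteq> cost (\<lambda>p. X p \<omega>) B"
proof -
  define s :: "nat \<times> nat \<Rightarrow> real" where "s q = (if q \<in> A then 1 else 0) - (if q \<in> B then 1 else 0)" for q
  define Y where "Y q \<omega> = s q * X q \<omega>" for q \<omega>
  obtain p where p: "p \<in> I" "p \<in> A - B \<or> p \<in> B - A" using AB by blast
  then have sp: "s p \<noteq> 0" unfolding s_def by auto
  have "indep_vars (\<lambda>_. borel) Y I"
    unfolding Y_def by (rule indep_vars_compose2[OF X_indep, of "\<lambda>q x. s q * x"]) auto
  then have "indep_vars (\<lambda>_. borel) Y (insert p (I - {p}))" using p(1) by (simp add: insert_absorb)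
  then have indep: "indep_var borel (Y p) borel (\<lambda>\<omega>. \<Sum>q\<in>I - {p}. Y q \<omega>)"
    using finite_I by (intro indep_vars_sum) auto
  define W where "W \<omega> = (\<Sum>q\<in>I - {p}. Y q \<omega>)" for \<omega>
  have W: "W \<in> borel_measurable M" unfolding W_def Y_def by measurable
  have Yp: "Y p \<in> borel_measurable M" unfolding Y_def using p(1) by measurable
  interpret W: prob_space "distr M borel W" using W by (rule prob_space_distr)
  interpret Yp: prob_space "distr M borel (Y p)" using Yp by (rule prob_space_distr)
  have joint: "distr M borel (Y p) \<Otimes>\<^sub>M distr M borel W = distr M (borel \<Otimes>\<^sub>M borel) (\<lambda>\<omega>. (Y p \<omega>, W \<omega>))"
    using indep_var_distribution_eq[THEN iffD1, OF indep] unfolding W_def by simp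
  interpret P: pair_prob_space "distr M borel (Y p)" "distr M borel W" ..
  \<comment> \<open>For fixed \<open>w\<close> the absence of atoms suffices. The two
    almost-everywhere quantifiers are then swapped and merged on the product, which is the joint law
    by independence.\<close>
  have "AE y in distr M borel (Y p). y + w \<noteq> 0" for w
  proof -
    have "AE \<omega> in M. Y p \<omega> + w \<noteq> 0"
      using AE_X_neq[OF p(1), of "- w / s p"]
      by (rule AE_mp) (use sp in \<open>auto simp: Y_def field_simps add_eq_0_iff\<close>)
    then show ?thesis using Yp by (subst AE_distr_iff) auto
  qed
  then have *: "AE w in distr M borel W. AE y in distr M borel (Y p). y + w \<noteq> 0" by simp
  have "{z \<in> space (borel \<Otimes>\<^sub>M borel). fst z + snd z \<noteq> (0 :: real)} \<in> sets (borel \<Otimes>\<^sub>M borel)"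
    by measurable
  then have meas: "{z \<in> space (distr M borel (Y p) \<Otimes>\<^sub>M distr M borel W). fst z + snd z \<noteq> 0}
      \<in> sets (distr M borel (Y p) \<Otimes>\<^sub>M distr M borel W)"
    by (simp add: space_pair_measure cong: sets_pair_measure_cong)
  have "AE y in distr M borel (Y p). AE w in distr M borel W. y + w \<noteq> 0"
    using * P.AE_commute[OF meas] by simp
  then have "AE z in distr M borel (Y p) \<Otimes>\<^sub>M distr M borel W. fst z + snd z \<noteq> 0"
    by (intro P.AE_pair_measure[OF meas]) auto
  then have neq: "AE \<omega> in M. Y p \<omega> + W \<omega> \<noteq> 0"
    unfolding joint using W Yp by (subst (asm) AE_distr_iff) auto
  have diff: "cost (\<lambda>p. X p \<omega>) A - cost (\<lambda>p. X p \<omega>) B = Y p \<omega> + W \<omega>" for \<omega>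
  proof -
    have "cost (\<lambda>p. X p \<omega>) C = (\<Sum>q\<in>I. (if q \<in> C then 1 else 0) * X q \<omega>)" if "C \<subseteq> I" for C
      unfolding cost_def using finite_I that
      by (intro sum.mono_neutral_cong_left) auto
    then have "cost (\<lambda>p. X p \<omega>) A - cost (\<lambda>p. X p \<omega>) B = (\<Sum>q\<in>I. Y q \<omega>)"
      using AB(1,2) unfolding Y_def s_def by (simp add: sum_subtractf left_diff_distrib)
    also have "\<dots> = Y p \<omega> + W \<omega>" unfolding W_def using finite_I p(1) by (simp add: sum.remove)
    finally show ?thesis .
  qed
  from neq show ?thesis
  proof eventually_elim
    case (elim \<omega>)
    then show ?case using diff[of \<omega>] by (metis diff_self)
  qed
qed

lemma AE_generic: "AE \<omega> in M. generic (\<lambda>p. X p \<omega>)"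
proof -
  have fI: "finite (Pow I)" using finite_I by simp
  have "AE \<omega> in M. \<forall>p\<in>I. 0 < X p \<omega>" using AE_X_pos finite_I by (intro AE_finite_allI) auto
  moreover have "AE \<omega> in M. \<forall>A\<in>Pow I. \<forall>B\<in>Pow I. A \<noteq> B \<longrightarrow> cost (\<lambda>p. X p \<omega>) A \<noteq> cost (\<lambda>p. X p \<omega>) B"
  proof (intro AE_finite_allI fI)
    fix A B assume "A \<in> Pow I" "B \<in> Pow I"
    then show "AE \<omega> in M. A \<noteq> B \<longrightarrow> cost (\<lambda>p. X p \<omega>) A \<noteq> cost (\<lambda>p. X p \<omega>) B"
      using AE_cost_neq[of A B] by (cases "A = B") auto
  qed
  ultimately show ?thesis using AE_space
  proof eventually_elim
    case (elim \<omega>)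
    show ?case unfolding generic_def
    proof (intro conjI allI impI ballI)
      fix A B assume AB: "A \<subseteq> I" "B \<subseteq> I" "cost (\<lambda>p. X p \<omega>) A = cost (\<lambda>p. X p \<omega>) B"
      then have "A \<in> Pow I" "B \<in> Pow I" by simp_all
      then show "A = B" using elim(2) AB(3) by metis
    qed (use elim X_zero in simp_all)
  qed
qed

section \<open>The events of a growth step and their invariance under row exchange\<close>

definition ev_good :: "nat set \<Rightarrow> 'a set" where
  "ev_good E = {\<omega> \<in> space M. good (\<lambda>p. X p \<omega>) E}"

definition ev_next :: "nat set \<Rightarrow> nat \<Rightarrow> 'a set" where
  "ev_next E a = ev_good E \<inter> ev_good (insert a E)"

lemma sets_ev_good [measurable]: "ev_good E \<in> sets M"
  unfolding ev_good_def by (rule sets_good[OF X_measurable_positions])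

lemma sets_ev_next [measurable]: "ev_next E a \<in> sets M"
  unfolding ev_next_def by simp

lemma distr_X: "p \<in> I \<Longrightarrow> distr M borel (X p) = density lborel (exponential_density 1)"
  using distributed_distr_eq_density[OF X_exponential, of p]
  by (subst distr_cong[of M M borel lborel]) auto

text \<open>The entries off \<open>Z\<close> are independent with one common law, so their joint law
  is a power of it, and reindexing along an injection of \<open>I\<close> into itself preserves this
  power.\<close>

lemma prob_permute:
  assumes \<pi>: "\<And>p. p \<in> I \<Longrightarrow> \<pi> p \<in> I" "inj_on \<pi> I" and U: "U \<in> sets (PiM I (\<lambda>_. borel))"
  shows "prob {\<omega> \<in> space M. (\<lambda>p\<in>I. X (\<pi> p) \<omega>) \<in> U} = prob {\<omega> \<in> space M. (\<lambda>p\<in>I. X p \<omega>) \<in> U}"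
proof -
  define D :: "real measure" where "D = density lborel (exponential_density 1)"
  define V where "V \<omega> = (\<lambda>p\<in>I. X p \<omega>)" for \<omega>
  define T :: "(nat \<times> nat \<Rightarrow> real) \<Rightarrow> nat \<times> nat \<Rightarrow> real" where "T x = (\<lambda>p\<in>I. x (\<pi> p))" for x
  let ?N = "PiM I (\<lambda>_. borel) :: (nat \<times> nat \<Rightarrow> real) measure"
  have D: "prob_space D"
    using prob_space_distr[OF X_measurable[OF r_in_I]] unfolding distr_X[OF r_in_I] D_def .
  have sD: "sets D = sets borel" unfolding D_def by simp
  have sN: "sets (PiM I (\<lambda>_. D)) = sets ?N" using sD by (intro sets_PiM_cong) auto
  have V: "V \<in> measurable M ?N" unfolding V_def by (intro measurable_restrict) simp
  have T: "T \<in> measurable ?N ?N"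
    unfolding T_def using \<pi>(1) by (intro measurable_restrict measurable_component_singleton)
  have "distr M ?N V = PiM I (\<lambda>p. distr M borel (X p))"
    unfolding V_def using X_indep r_in_I
    by (subst indep_vars_iff_distr_eq_PiM'[symmetric]) auto
  also have "\<dots> = PiM I (\<lambda>_. D)" by (intro PiM_cong) (simp_all add: distr_X D_def)
  finally have dV: "distr M ?N V = PiM I (\<lambda>_. D)" .
  have "distr M ?N (T \<circ> V) = distr (PiM I (\<lambda>_. D)) ?N T"
    using distr_distr[OF T V] unfolding dV by simp
  also have "\<dots> = distr (PiM I (\<lambda>_. D)) (PiM I (\<lambda>_. D)) T"
    using sN by (intro distr_cong) auto
  also have "\<dots> = PiM I (\<lambda>_. D)"
    unfolding T_def using \<pi> D by (intro distr_PiM_reindex) auto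
  finally have eq: "distr M ?N (T \<circ> V) = distr M ?N V" using dV by simp
  have TV: "T \<circ> V \<in> measurable M ?N" using V T by (rule measurable_comp)
  have "T (V \<omega>) = (\<lambda>p\<in>I. X (\<pi> p) \<omega>)" for \<omega>
    unfolding T_def V_def using \<pi>(1) by (auto simp: restrict_def)
  then have "prob {\<omega> \<in> space M. (\<lambda>p\<in>I. X (\<pi> p) \<omega>) \<in> U} = prob ((T \<circ> V) -` U \<inter> space M)"
    by (intro arg_cong[of _ _ prob]) auto
  also have "\<dots> = measure (distr M ?N (T \<circ> V)) U" using TV U by (simp add: measure_distr)
  also have "\<dots> = prob (V -` U \<inter> space M)" unfolding eq using V U by (simp add: measure_distr)
  also have "V -` U \<inter> space M = {\<omega> \<in> space M. (\<lambda>p\<in>I. X p \<omega>) \<in> U}" unfolding V_def by auto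
  finally show ?thesis .
qed

text \<open>
  The rows outside \<open>E\<close>, restricted to the columns in \<open>cols E\<close>, consist of independent
  identically distributed entries, so exchanging two of them preserves the distribution.
\<close>
lemma prob_ev_next_eq:
  assumes flat: "flat j E" and a: "a \<in> {..<m} - E" and a': "a' \<in> {..<m} - E"
  shows "prob (ev_next E a) = prob (ev_next E a')"
proof -
  define \<tau> where "\<tau> x = (if x = a then a' else if x = a' then a else x)" for x
  \<comment> \<open>\<open>\<pi>\<close> exchanges the two rows only within \<open>cols E\<close>,
    where rows outside \<open>E\<close> have no zeros; so it fixes \<open>Z\<close> pointwise and
    permutes \<open>I\<close>.\<close>
  define \<pi> where "\<pi> = (\<lambda>(x, d). if d \<in> cols E then (\<tau> x, d) else (x, d))"
  \<comment> \<open>The product space has coordinates in \<open>I\<close> only; \<open>ext\<close>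
    supplies the zeros elsewhere, so that both events become membership in one set
    \<open>U\<close>.\<close>
  define ext where "ext x p = (if p \<in> I then x p else 0)" for x :: "nat \<times> nat \<Rightarrow> real" and p
  define U where "U = {x \<in> space (PiM I (\<lambda>_. borel)). good (ext x) E \<and> good (ext x) (insert a E)}"
  have \<tau>: "\<tau> (\<tau> x) = x" "x < m \<Longrightarrow> \<tau> x < m" "x \<in> E \<Longrightarrow> \<tau> x = x" "\<tau> x \<in> E \<Longrightarrow> x \<in> E" for x
    unfolding \<tau>_def using a a' by (auto split: if_splits)
  have \<tau>E: "\<tau> ` E = E" using \<tau>(3) by force
  have \<tau>a: "\<tau> ` insert a E = insert a' E" "\<tau> ` insert a' E = insert a E"
    using \<tau>E unfolding \<tau>_def by auto
  have cols: "cols (insert a E) = cols E" "cols (insert a' E) = cols E"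
    using flat_cols_insert[OF flat] a a' by auto
  have \<pi>Z: "\<pi> p = p" if "p \<in> Z" for p
    using that cols_nonzero[of "snd p" E "fst p"] \<tau>(3) unfolding \<pi>_def by (cases p) auto
  have \<pi>\<pi>: "\<pi> (\<pi> p) = p" for p using \<tau>(1) unfolding \<pi>_def by (cases p) auto
  have \<pi>pos: "\<pi> p \<in> positions m n" if "p \<in> positions m n" for p
    using that \<tau>(2) unfolding \<pi>_def positions_def by (cases p) auto
  have \<pi>I: "\<pi> p \<in> I" if "p \<in> I" for p
    using that \<pi>pos \<pi>\<pi> \<pi>Z by (metis DiffD1 DiffD2 DiffI)
  have inj: "inj_on \<pi> I" using \<pi>\<pi> by (metis inj_onI)
  have meas: "(\<lambda>x. ext x p) \<in> borel_measurable (PiM I (\<lambda>_. borel))" for p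
    unfolding ext_def by (cases "p \<in> I") auto
  have U: "U \<in> sets (PiM I (\<lambda>_. borel))"
    unfolding U_def by (intro sets.sets_Collect_conj sets_good meas)
  have sp: "(\<lambda>p\<in>I. f p) \<in> space (PiM I (\<lambda>_. borel))" for f :: "nat \<times> nat \<Rightarrow> real"
    by (auto simp: space_PiM)
  have 1: "{\<omega> \<in> space M. (\<lambda>p\<in>I. X p \<omega>) \<in> U} = ev_next E a"
  proof -
    have "good (ext (\<lambda>p\<in>I. X p \<omega>)) F \<longleftrightarrow> good (\<lambda>p. X p \<omega>) F" if "\<omega> \<in> space M" for \<omega> F
      using that X_zero by (intro good_cong) (auto simp: ext_def)
    then show ?thesis unfolding U_def ev_next_def ev_good_def using sp by auto
  qed
  have 2: "{\<omega> \<in> space M. (\<lambda>p\<in>I. X (\<pi> p) \<omega>) \<in> U} = ev_next E a'"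
  proof -
    have *: "good (ext (\<lambda>p\<in>I. X (\<pi> p) \<omega>)) F \<longleftrightarrow> good (\<lambda>p. X (\<pi> p) \<omega>) F" if "\<omega> \<in> space M" for \<omega> F
      using that X_zero \<pi>Z by (intro good_cong) (auto simp: ext_def)
    \<comment> \<open>Goodness of \<open>F\<close> reads only the columns \<open>cols F\<close>;
      when these are \<open>cols E\<close>, permuting by \<open>\<pi>\<close> amounts to exchanging
      the two rows entirely.\<close>
    have **: "good (\<lambda>p. X (\<pi> p) \<omega>) F \<longleftrightarrow> good (\<lambda>p. X p \<omega>) (\<tau> ` F)"
      if F: "cols F = cols E" "cols (\<tau> ` F) = cols E" for \<omega> F
    proof
      assume "good (\<lambda>p. X (\<pi> p) \<omega>) F"
      then show "good (\<lambda>p. X p \<omega>) (\<tau> ` F)"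
        by (rule good_permute[OF _ \<tau>(1,2)]) (simp_all add: \<pi>_def F)
    next
      have \<tau>\<tau>: "\<tau> ` \<tau> ` F = F" by (simp add: image_image \<tau>(1))
      assume "good (\<lambda>p. X p \<omega>) (\<tau> ` F)"
      then have "good (\<lambda>p. X (\<pi> p) \<omega>) (\<tau> ` \<tau> ` F)"
        by (rule good_permute[OF _ \<tau>(1,2)]) (simp_all add: \<pi>_def F \<tau>\<tau> \<tau>(1))
      then show "good (\<lambda>p. X (\<pi> p) \<omega>) F" unfolding \<tau>\<tau> .
    qed
    have "good (\<lambda>p. X (\<pi> p) \<omega>) E \<longleftrightarrow> good (\<lambda>p. X p \<omega>) E"
      "good (\<lambda>p. X (\<pi> p) \<omega>) (insert a E) \<longleftrightarrow> good (\<lambda>p. X p \<omega>) (insert a' E)" for \<omega>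
      using **[of E \<omega>] **[of "insert a E" \<omega>] \<tau>E \<tau>a cols by auto
    then show ?thesis unfolding U_def ev_next_def ev_good_def using sp * by auto
  qed
  show ?thesis using prob_permute[OF \<pi>I inj U] unfolding 1 2 by simp
qed

end

section \<open>The growth of the flats\<close>

context free_row_RAP
begin

abbreviation costs :: "'a \<Rightarrow> nat \<times> nat \<Rightarrow> real" where
  "costs \<omega> \<equiv> \<lambda>p. X p \<omega>"

definition flats :: "nat \<Rightarrow> nat set set" where
  "flats j = {E. flat j E}"

definition reaches :: "nat \<Rightarrow> bool" where
  "reaches j \<longleftrightarrow> (AE \<omega> in M. \<exists>E\<in>flats j. good (costs \<omega>) E)"

lemma finite_flats: "finite (flats j)"
  by (rule finite_subset[of _ "Pow {..<m}"]) (auto simp: flats_def flat_def preflat_def)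

lemma flatsD: "E \<in> flats j \<Longrightarrow> flat j E \<and> E \<subseteq> {..<m} \<and> finite E \<and> card E \<le> j"
  using preflatD[of j E] unfolding flats_def flat_def by auto

text \<open>Almost surely exactly one flat of rank \<open>j\<close> is good, namely the set
  \<open>ess\<close>, so the indicators select a single term.\<close>

lemma AE_sum_good:
  assumes "reaches j"
  shows "AE \<omega> in M. (\<Sum>E\<in>flats j. indicator (ev_good E) \<omega> * f E) = (f (ess j m n (costs \<omega>)) :: real)"
  using assms[unfolded reaches_def] AE_generic AE_space
proof eventually_elim
  case (elim \<omega>)
  then obtain E where E: "E \<in> flats j" "good (costs \<omega>) E" by blast
  have ess: "E' = ess j m n (costs \<omega>)" if "E' \<in> flats j" "good (costs \<omega>) E'" for E'
    using good_ess[OF elim(2)] flatsD[OF that(1)] that(2) by blast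
  have "(\<Sum>E'\<in>flats j. indicator (ev_good E') \<omega> * f E') = (\<Sum>E'\<in>flats j. if E' = E then f E' else 0)"
  proof (rule sum.cong)
    fix E' assume E': "E' \<in> flats j"
    have "\<omega> \<in> ev_good E' \<longleftrightarrow> E' = E"
      using ess[OF E'] ess[OF E] E(2) elim(3) unfolding ev_good_def by blast
    then show "indicator (ev_good E') \<omega> * f E' = (if E' = E then f E' else 0)"
      by (simp add: indicator_def)
  qed simp
  also have "\<dots> = f E" using E(1) finite_flats by simp
  finally show ?case using ess[OF E] by simp
qed

lemma generic_next:
  assumes "generic (costs \<omega>)" "\<omega> \<in> space M" "flat j E" "good (costs \<omega>) E" "j < k"
  obtains a where "a \<in> {..<m} - E" "good (costs \<omega>) (insert a E)"
    "\<And>b. b \<in> {..<m} - E \<Longrightarrow> \<omega> \<in> ev_next E b \<longleftrightarrow> b = a"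
proof -
  have "j < m" "j < n" using assms(5) k_m k_n by auto
  from good_next[OF assms(1,3,4) this]
  obtain a where a: "a \<in> {..<m} - E" "good (costs \<omega>) (insert a E)"
    "\<And>b. b \<in> {..<m} - E \<Longrightarrow> good (costs \<omega>) (insert b E) \<Longrightarrow> b = a" by (elim ex1E) blast
  have "\<omega> \<in> ev_next E b \<longleftrightarrow> b = a" if "b \<in> {..<m} - E" for b
    using a(2) a(3)[OF that] assms(2,4) unfolding ev_next_def ev_good_def by blast
  then show ?thesis using that a by blast
qed

text \<open>Up to a null set \<open>ev_good E\<close> is the disjoint union of the events
  \<open>ev_next E b\<close>, by \<open>good_next\<close>, and these are equally likely by
  exchangeability.\<close>

lemma prob_ev_next:
  assumes flat: "flat j E" and j: "j < k" and a: "a \<in> {..<m} - E"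
  shows "real (m - card E) * prob (ev_next E a) = prob (ev_good E)"
proof -
  have E: "E \<subseteq> {..<m}" "finite E" using flat flatsD[of E j] unfolding flats_def by auto
  have "AE \<omega> in M. indicator (ev_good E) \<omega> = (\<Sum>b\<in>{..<m} - E. indicator (ev_next E b) \<omega> :: real)"
    using AE_generic AE_space
  proof eventually_elim
    case (elim \<omega>)
    show ?case
    proof (cases "good (costs \<omega>) E")
      case True
      obtain a' where a': "a' \<in> {..<m} - E"
        "\<And>b. b \<in> {..<m} - E \<Longrightarrow> \<omega> \<in> ev_next E b \<longleftrightarrow> b = a'"
        using generic_next[OF elim flat True j] by metis
      have "(\<Sum>b\<in>{..<m} - E. indicator (ev_next E b) \<omega>) = (\<Sum>b\<in>{..<m} - E. if b = a' then 1 else (0::real))"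
        by (rule sum.cong) (simp_all add: a'(2) indicator_def)
      then show ?thesis using a'(1) True elim(2) by (simp add: ev_good_def indicator_def)
    next
      case False
      then have "\<omega> \<notin> ev_good E" "\<And>b. \<omega> \<notin> ev_next E b" unfolding ev_next_def ev_good_def by auto
      then show ?thesis by simp
    qed
  qed
  then have "(\<integral>\<omega>. indicator (ev_good E) \<omega> \<partial>M)
      = (\<integral>\<omega>. (\<Sum>b\<in>{..<m} - E. indicator (ev_next E b) \<omega> :: real) \<partial>M)"
    by (intro integral_cong_AE) auto
  also have "\<dots> = (\<Sum>b\<in>{..<m} - E. prob (ev_next E b))"
    by (subst Bochner_Integration.integral_sum) (auto simp: emeasure_eq_measure)
  also have "\<dots> = (\<Sum>b\<in>{..<m} - E. prob (ev_next E a))"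
    by (intro sum.cong) (simp_all add: prob_ev_next_eq[OF flat _ a])
  also have "\<dots> = real (m - card E) * prob (ev_next E a)"
    using E by (simp add: card_Diff_subset)
  finally show ?thesis by simp
qed

text \<open>When \<open>reaches j\<close> holds, this is the expected value of \<open>hit\<close> at
  the random flat \<open>ess\<close>; it is the invariant of the growth.\<close>

definition total :: "nat \<Rightarrow> real" where
  "total j = (\<Sum>E\<in>flats j. prob (ev_good E) * hit E)"

lemma total_eq: "total j = (\<integral>\<omega>. (\<Sum>E\<in>flats j. indicator (ev_good E) \<omega> * hit E) \<partial>M)"
  unfolding total_def
  by (subst Bochner_Integration.integral_sum) (auto simp: emeasure_eq_measure)

text \<open>A martingale argument: given the flat \<open>E\<close>, the added row is uniform outside
  \<open>E\<close>, so \<open>hit (insert a E)\<close> averages to \<open>hit E\<close> by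
  \<open>hit_first\<close>, and the subsequent closure leaves \<open>hit\<close> unchanged.\<close>

lemma total_Suc:
  assumes reach: "reaches j" and j: "j < k"
  shows "reaches (Suc j)" "total (Suc j) = total j"
proof -
  \<comment> \<open>One almost sure statement serves both claims: the next flat exists, and its
    \<open>hit\<close> is read off from the row added to the current flat.\<close>
  have step: "AE \<omega> in M. (\<exists>E\<in>flats (Suc j). good (costs \<omega>) E) \<and>
    (\<Sum>E\<in>flats j. \<Sum>a\<in>{..<m} - E. indicator (ev_next E a) \<omega> * hit (insert a E))
      = hit (ess (Suc j) m n (costs \<omega>))"
    using reach[unfolded reaches_def] AE_generic AE_space
  proof eventually_elim
    case (elim \<omega>)
    then obtain E where E: "E \<in> flats j" "good (costs \<omega>) E" by blast
    have flat: "flat j E" using flatsD[OF E(1)] by blast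
    obtain a where a: "a \<in> {..<m} - E" "good (costs \<omega>) (insert a E)"
      "\<And>b. b \<in> {..<m} - E \<Longrightarrow> \<omega> \<in> ev_next E b \<longleftrightarrow> b = a"
      using generic_next[OF elim(2,3) flat E(2) j] by metis
    obtain E' where E': "flat (Suc j) E'" "good (costs \<omega>) E'" "hit E' = hit (insert a E)"
      using hit_next[OF elim(2) flat a(1,2)] by blast
    have ess: "F = ess j m n (costs \<omega>)" if "F \<in> flats j" "good (costs \<omega>) F" for F
      using good_ess[OF elim(2)] flatsD[OF that(1)] that(2) by blast
    have uniq: "F = E" if "F \<in> flats j" "\<omega> \<in> ev_next F b" for F b
      using that ess[OF E] ess[OF that(1)] unfolding ev_next_def ev_good_def by simp
    have "(\<Sum>F\<in>flats j. \<Sum>b\<in>{..<m} - F. indicator (ev_next F b) \<omega> * hit (insert b F))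
      = (\<Sum>F\<in>flats j. if F = E then hit (insert a E) else 0)"
    proof (rule sum.cong)
      fix F assume F: "F \<in> flats j"
      show "(\<Sum>b\<in>{..<m} - F. indicator (ev_next F b) \<omega> * hit (insert b F))
        = (if F = E then hit (insert a E) else 0)"
      proof (cases "F = E")
        case True
        have "(\<Sum>b\<in>{..<m} - E. indicator (ev_next E b) \<omega> * hit (insert b E))
          = (\<Sum>b\<in>{..<m} - E. if b = a then hit (insert b E) else 0)"
          by (rule sum.cong) (simp_all add: a(3) indicator_def)
        then show ?thesis using True a(1) by simp
      next
        case False
        then have "\<omega> \<notin> ev_next F b" for b using uniq[OF F] by blast
        then show ?thesis using False by simp
      qed
    qed simp
    also have "\<dots> = hit (insert a E)" using E(1) finite_flats by simp
    also have "\<dots> = hit (ess (Suc j) m n (costs \<omega>))"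
      using good_ess[OF elim(2) E'(1,2)] E'(3) by simp
    finally show ?case using E' unfolding flats_def by blast
  qed
  show reach': "reaches (Suc j)"
    unfolding reaches_def using step by eventually_elim blast
  have ae: "AE \<omega> in M. (\<Sum>E\<in>flats (Suc j). indicator (ev_good E) \<omega> * hit E)
    = (\<Sum>E\<in>flats j. \<Sum>a\<in>{..<m} - E. indicator (ev_next E a) \<omega> * hit (insert a E))"
    using AE_sum_good[OF reach'] step by eventually_elim simp
  let ?g = "\<lambda>E a \<omega>. indicator (ev_next E a) \<omega> * hit (insert a E)"
  have int: "integrable M (?g E a)" for E a by (simp add: emeasure_eq_measure)
  have int_eq: "(\<integral>\<omega>. ?g E a \<omega> \<partial>M) = prob (ev_next E a) * hit (insert a E)" for E a by simp
  have "total (Suc j) = (\<integral>\<omega>. (\<Sum>E\<in>flats j. \<Sum>a\<in>{..<m} - E. ?g E a \<omega>) \<partial>M)"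
    unfolding total_eq
    by (intro integral_cong_AE[OF _ _ ae] borel_measurable_sum borel_measurable_times
        borel_measurable_indicator borel_measurable_const sets_ev_next sets_ev_good)
  also have "\<dots> = (\<Sum>E\<in>flats j. \<integral>\<omega>. (\<Sum>a\<in>{..<m} - E. ?g E a \<omega>) \<partial>M)"
    by (intro Bochner_Integration.integral_sum Bochner_Integration.integrable_sum int)
  also have "\<dots> = (\<Sum>E\<in>flats j. \<Sum>a\<in>{..<m} - E. prob (ev_next E a) * hit (insert a E))"
    unfolding int_eq[symmetric] by (intro sum.cong refl Bochner_Integration.integral_sum int)
  also have "\<dots> = (\<Sum>E\<in>flats j. prob (ev_good E) * hit E)"
  proof (rule sum.cong)
    fix E assume "E \<in> flats j"
    then have E: "flat j E" "E \<subseteq> {..<m}" "card E \<le> j" using flatsD by auto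
    have pos: "real (m - card E) > 0" using E(3) j k_m by simp
    have p: "prob (ev_next E a) = prob (ev_good E) / real (m - card E)" if "a \<in> {..<m} - E" for a
      using prob_ev_next[OF E(1) j that] pos by (simp add: field_simps)
    \<comment> \<open>Since \<open>j < k\<close>, the rows \<open>E\<close> with the columns
      \<open>zcols E\<close> form a cover of at most \<open>k - 1\<close> lines.\<close>
    have "extendable E" using E(1) j by (intro preflat_extendable[of j]) (auto simp: flat_def)
    then have h1: "real (m - card E) * hit E = (\<Sum>a\<in>{..<m} - E. hit (insert a E))" by (rule hit_first[OF E(2)])
    have h2: "(\<Sum>a\<in>{..<m} - E. prob (ev_next E a) * hit (insert a E))
      = prob (ev_good E) / real (m - card E) * (\<Sum>a\<in>{..<m} - E. hit (insert a E))"
      by (simp add: p sum_distrib_left)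
    show "(\<Sum>a\<in>{..<m} - E. prob (ev_next E a) * hit (insert a E)) = prob (ev_good E) * hit E"
      unfolding h2 h1[symmetric] using pos by (simp del: of_nat_diff)
  qed simp
  finally show "total (Suc j) = total j" unfolding total_def .
qed

lemma total_const:
  assumes "reaches i" "i \<le> j" "j \<le> k"
  shows "reaches j \<and> total j = total i"
  using assms(2,3)
proof (induction j rule: dec_induct)
  case base
  then show ?case using assms(1) by simp
next
  case (step j)
  then show ?case using total_Suc[of j] by simp
qed

lemma reaches_if_good:
  assumes "flat j E" "\<forall>c. generic c \<longrightarrow> good c E"
  shows "reaches j \<and> total j = hit E"
proof
  show reach: "reaches j" unfolding reaches_def
    using AE_generic by eventually_elim (use assms in \<open>auto simp: flats_def\<close>)
  have "AE \<omega> in M. (\<Sum>E\<in>flats j. indicator (ev_good E) \<omega> * hit E) = hit E"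
    using AE_sum_good[OF reach, of hit] AE_generic
  proof eventually_elim
    case (elim \<omega>)
    then show ?case using good_ess[OF elim(2) assms(1)] assms(2) by simp
  qed
  then have "total j = (\<integral>\<omega>. hit E \<partial>M)" unfolding total_eq by (intro integral_cong_AE) auto
  then show "total j = hit E" by (simp add: prob_space)
qed

section \<open>The event that row \<open>r\<close> is used\<close>

definition ev_every :: "'a set" where
  "ev_every = {\<omega> \<in> space M. \<forall>A. optimal_assignment k m n (costs \<omega>) A \<longrightarrow> uses_row r A}"

definition ev_some :: "'a set" where
  "ev_some = {\<omega> \<in> space M. \<exists>A. optimal_assignment k m n (costs \<omega>) A \<and> uses_row r A}"

lemma sets_optimal: "{\<omega> \<in> space M. optimal_assignment k m n (costs \<omega>) A} \<in> sets M"
proof (cases "k_assignment k m n A")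
  case True
  have fin: "finite {B. k_assignment k m n B}"
    unfolding k_assignment_asg by (rule finite_asg) simp
  have "{\<omega> \<in> space M. optimal_assignment k m n (costs \<omega>) A}
    = {\<omega> \<in> space M. \<forall>B\<in>{B. k_assignment k m n B}. cost (costs \<omega>) A \<le> cost (costs \<omega>) B}"
    using True unfolding optimal_assignment_def by auto
  also have "\<dots> \<in> sets M"
  proof (intro sets.sets_Collect_finite_All' fin)
    fix B assume "B \<in> {B. k_assignment k m n B}"
    then show "{\<omega> \<in> space M. cost (costs \<omega>) A \<le> cost (costs \<omega>) B} \<in> sets M"
      using True unfolding k_assignment_def by (intro borel_measurable_le cost_measurable) auto
  qed (use True in auto)
  finally show ?thesis .
next
  case False
  then show ?thesis unfolding optimal_assignment_def by simp
qed

lemma sets_ev_some: "ev_some \<in> sets M"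
proof -
  have fin: "finite {B. k_assignment k m n B \<and> uses_row r B}"
    unfolding k_assignment_asg by (rule finite_subset[OF _ finite_asg[of "{..<n}" m k]]) auto
  have "ev_some = {\<omega> \<in> space M. \<exists>A\<in>{B. k_assignment k m n B \<and> uses_row r B}.
      optimal_assignment k m n (costs \<omega>) A}"
    unfolding ev_some_def optimal_assignment_def by auto
  also have "\<dots> \<in> sets M" by (intro sets.sets_Collect_finite_Ex sets_optimal fin)
  finally show ?thesis .
qed

lemma sets_ev_every: "ev_every \<in> sets M"
proof -
  have fin: "finite {B. k_assignment k m n B \<and> \<not> uses_row r B}"
    unfolding k_assignment_asg by (rule finite_subset[OF _ finite_asg[of "{..<n}" m k]]) auto
  have "ev_every = space M - {\<omega> \<in> space M. \<exists>A\<in>{B. k_assignment k m n B \<and> \<not> uses_row r B}.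
      optimal_assignment k m n (costs \<omega>) A}"
    unfolding ev_every_def optimal_assignment_def by auto
  also have "\<dots> \<in> sets M" by (intro sets.compl_sets sets.sets_Collect_finite_Ex sets_optimal fin)
  finally show ?thesis .
qed

lemma optimal_exists: "\<exists>A. optimal_assignment k m n c A"
  unfolding optimal_assignment_opt using k_m k_n by (intro opt_exists) auto

lemma generic_optimal_unique:
  assumes "generic c" "optimal_assignment k m n c A" "optimal_assignment k m n c B"
  shows "A - Z = B - Z"
proof -
  have "cost c A = cost c B" "asg m {..<n} k A" "asg m {..<n} k B"
    using assms(2,3) unfolding optimal_assignment_opt opt_def by (auto intro: order_antisym)
  then show ?thesis using generic_unique[OF assms(1)] by blast
qed

text \<open>Row \<open>r\<close> has no zeros, so an optimal assignment using it does so off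
  \<open>Z\<close>, and under generic costs all optimal assignments share that position.\<close>

lemma prob_ev_some: "prob ev_some = prob ev_every"
proof (rule finite_measure_eq_AE)
  show "AE \<omega> in M. \<omega> \<in> ev_some \<longleftrightarrow> \<omega> \<in> ev_every"
    using AE_generic AE_space
  proof eventually_elim
    case (elim \<omega>)
    have "uses_row r B" if A: "optimal_assignment k m n (costs \<omega>) A" "uses_row r A"
      and B: "optimal_assignment k m n (costs \<omega>) B" for A B
    proof -
      obtain j where "(r, j) \<in> A - Z" using A(2) free unfolding uses_row_def by blast
      then show ?thesis using generic_optimal_unique[OF elim(1) A(1) B] unfolding uses_row_def by blast
    qed
    then show ?case unfolding ev_some_def ev_every_def using elim(2) optimal_exists by blast
  qed
qed (rule sets_ev_some sets_ev_every)+

text \<open>At rank \<open>k\<close> the value \<open>hit E\<close> is the indicator of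
  \<open>r \<in> E\<close>, and the good flat \<open>E\<close> is almost surely the set of rows used
  by every optimal assignment.\<close>

lemma prob_ev_every_eq_total:
  assumes "reaches k"
  shows "prob ev_every = total k"
proof -
  have "AE \<omega> in M. (\<Sum>E\<in>flats k. indicator (ev_good E) \<omega> * hit E) = indicator ev_every \<omega>"
    using AE_sum_good[OF assms, of hit] assms[unfolded reaches_def] AE_generic AE_space
  proof eventually_elim
    case (elim \<omega>)
    then obtain E where E: "E \<in> flats k" "good (costs \<omega>) E" by blast
    then have ess: "ess k m n (costs \<omega>) = E" using good_ess[OF elim(3)] flatsD by blast
    have "preflat k E" using E(1) unfolding flats_def flat_def by blast
    then have "hit E = (if r \<in> E then 1 else 0)" by (rule hit_flat)
    moreover have "r \<in> E \<longleftrightarrow> \<omega> \<in> ev_every"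
      unfolding ess[symmetric] ess_def ev_every_def using row elim(4) by simp
    ultimately show ?case using elim(1) ess by (simp add: indicator_def)
  qed
  then have "total k = (\<integral>\<omega>. indicator ev_every \<omega> \<partial>M)"
    unfolding total_eq using sets_ev_every by (intro integral_cong_AE) auto
  then show ?thesis using sets_ev_every sets.sets_into_space[OF sets_ev_every]
    by (simp add: Int_absorb2)
qed

text \<open>The degenerate case: \<open>k\<close> independent zeros almost surely form an optimal
  assignment, it avoids \<open>r\<close>, and \<open>k - 1\<close> lines cannot cover these
  zeros.\<close>

lemma many_zeros:
  assumes A: "A \<subseteq> Z" "matching A" "k \<le> card A"
  shows "prob ev_every = 0" "hit {} = 0"
proof -
  obtain C where C: "C \<subseteq> A" "card C = k" using obtain_subset_with_card_n[OF A(3)] by metis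
  have CZ: "C \<subseteq> Z" using C(1) A(1) by blast
  have "C \<subseteq> {..<m} \<times> {..<n}" using CZ Z_sub unfolding positions_def by blast
  then have aC: "asg m {..<n} k C"
    using matching_subset[OF A(2) C(1)] C(2) unfolding asg_def matching_def by blast
  have "AE \<omega> in M. \<omega> \<notin> ev_every"
    using AE_generic
  proof eventually_elim
    case (elim \<omega>)
    have "0 \<le> cost (costs \<omega>) D" if "asg m {..<n} k D" for D
      unfolding cost_def using that generic_nonneg[OF elim] unfolding asg_def
      by (intro sum_nonneg) auto
    then have "optimal_assignment k m n (costs \<omega>) C"
      unfolding optimal_assignment_opt opt_def using aC cost_zeros[OF elim CZ] by simp
    moreover have "\<not> uses_row r C" using CZ free unfolding uses_row_def by blast
    ultimately show ?case unfolding ev_every_def by blast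
  qed
  then show "prob ev_every = 0" using sets_ev_every by (simp add: prob_eq_0)
  have "\<not> extendable R" for R using not_extendable[OF A(1,2), of "{}" R] A(3) by simp
  then show "hit {} = 0" unfolding hit_def by simp
qed

text \<open>The invariant \<open>total\<close> is \<open>hit {}\<close> at the starting rank and the
  desired probability at rank \<open>k\<close>; if the start lies at or beyond rank
  \<open>k\<close>, both sides vanish.\<close>

lemma prob_ev_every: "prob ev_every = hit {}"
proof -
  obtain j E A where *: "flat j E" "\<forall>c. generic c \<longrightarrow> good c E" "hit E = hit {}"
    "A \<subseteq> Z" "matching A" "card A = j" by (rule start_flat)
  show ?thesis
  proof (cases "k \<le> j")
    case True
    then show ?thesis using many_zeros[OF *(4,5)] *(6) by simp
  next
    case False
    have "reaches j" "total j = hit E" using reaches_if_good[OF *(1,2)] by auto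
    then have "reaches k" "total k = hit E" using total_const[of j k] False by auto
    then show ?thesis using prob_ev_every_eq_total *(3) by simp
  qed
qed

end

theorem theorem4p1:
  fixes M :: "'a measure" and k m n r :: nat
    and Z :: "(nat \<times> nat) set" and X :: "nat \<times> nat \<Rightarrow> 'a \<Rightarrow> real"
  assumes "standard_RAP M k m n Z X"
    and "r < m"
    and "\<And>j. (r, j) \<notin> Z"
  shows "measure M {\<omega> \<in> space M.
           \<exists>A. optimal_assignment k m n (\<lambda>p. X p \<omega>) A \<and> uses_row r A}
         = 1 / real m *
             (\<Sum>i = 0..k - 1. real (d_bar_row k m n Z r i) / real ((m - 1) choose i))
       \<and> measure M {\<omega> \<in> space M.
           \<forall>A. optimal_assignment k m n (\<lambda>p. X p \<omega>) A \<longrightarrow> uses_row r A}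
         = 1 / real m *
             (\<Sum>i = 0..k - 1. real (d_bar_row k m n Z r i) / real ((m - 1) choose i))"
proof -
  interpret standard_RAP M k m n Z X by (rule assms(1))
  interpret free_row_RAP M k m n Z X r
    by unfold_locales (use assms(2,3) in auto)
  show ?thesis
    using prob_ev_some prob_ev_every unfolding hit_empty ev_some_def ev_every_def by simp
qed

end
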